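(* The volume term of the conservative discontinuous Galerkin (DG) strong form, $$\int_{\Omega_r}\chi_i(\xi)\Big(\sum_{j=1}^{N_p}\nabla^r\chi_j(\xi)\cdot\hat{\bm f}^r_{m,j}\Big)\,d\Omega_r ,\qquad i=1,\dots,N_p,$$ and the volume term of the non-conservative DG strong form, $$\int_{\Omega_r}\chi_i(\xi)\Big(\sum_{j=1}^{N_p}\big(\nabla^r\chi_j(\xi)\,C_m^T\big)\cdot\hat{\bm f}_{m,j}\Big)\,d\Omega_r ,\qquad i=1,\dots,N_p,$$ are inherently different for a curvilinear mesh, even with exact integration and exact metric terms.
   Context: Consider a conservation law $\partial_t u+\nabla\cdot\bm f(u)=0$ in $d$ space dimensions (three-dimensional setting), with flux row vector $\bm f=(f_1,\dots,f_d)$. The domain is partitioned into elements $\Omega_m$, each the image of the reference element $\Omega_r=[-1,1]^d$ under a mapping $x=\Theta_m(\xi)$; the mesh is curvilinear when these mappings are not linear. $J_m^\Omega$ is the determinant of the metric Jacobian matrix $\partial x/\partial\xi$, and $C_m$ is the metric cofactor matrix, $C_m^T=J_m^\Omega(\partial x/\partial\xi)^{-1}$, so $(C_m)_{nk}=J_m^\Omega\,\partial\xi_k/\partial x_n$. These are the metric terms. $\nabla^r$ is the gradient (row vector) in the reference variables. $\chi_1,\dots,\chi_{N_p}$, $N_p=(p+1)^d$, is a tensor-product polynomial basis (modal or nodal) of order $p$ in each reference direction, and the discrete solution on the element is $u_m^h=\sum_i\chi_i\hat u_{m,i}$. The reference flux is the row vector $\bm f_m^r=\bm f_m C_m$, where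 $\bm f_m=\bm f(u_m^h)$ is the physical flux. $\Pi$ denotes the $L_2$ projection onto the reference polynomial basis, returning the vector of coefficients in the basis and applied to each flux component; $\hat{\bm f}^r_{m,j}=[\Pi(\bm f_m C_m)]_j$ and $\hat{\bm f}_{m,j}=[\Pi(\bm f_m)]_j$ are the $j$th coefficients of the projected reference flux and of the projected physical flux. The conservative strong form is obtained by transforming the physical weak form to the reference element, projecting the reference flux onto the polynomial basis, and integrating by parts in reference space. The non-conservative strong form is obtained by projecting the physical flux onto the basis, integrating by parts in physical space, and then transforming to the reference element. "Inherently different" is meant in the sense that the two volume terms cannot be equivalent for a general flux $\bm f(u_m^h)$. *)

theory Defs
  imports "HOL-Analysis.Analysis" "HOL-Computational_Algebra.Polynomial"
begin

text \<open>The space dimension \<open>d\<close> is \<open>CARD('n)\<close>; points, row vectors and gradients are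
  elements of \<open>real ^ 'n\<close>, and a row vector acts on a matrix from the left by \<open>v*\<close>.\<close>

definition ref_element :: "(real ^ 'n) set" where
  "ref_element = cbox (\<chi> k. -1) (\<chi> k. 1)"

subsection \<open>Mesh and metric terms\<close>

text \<open>Derivatives of a mapping are taken within the reference element, so that a mapping
  need only be given there; they are still unique, also on the boundary of the cube.\<close>

definition metric_jacobian :: "(real ^ 'n \<Rightarrow> real ^ 'n) \<Rightarrow> real ^ 'n \<Rightarrow> real ^ 'n ^ 'n" where
  "metric_jacobian \<Theta> \<xi> = jacobian \<Theta> (at \<xi> within ref_element)"

text \<open>\<open>C\<^sup>T = J (\<partial>x/\<partial>\<xi>)\<^sup>-\<^sup>1\<close> with \<open>J = det (\<partial>x/\<partial>\<xi>)\<close>, i.e.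
  \<open>C $ n $ k = J \<partial>\<xi>\<^sub>k/\<partial>x\<^sub>n\<close>.\<close>

definition metric_cofactor :: "(real ^ 'n \<Rightarrow> real ^ 'n) \<Rightarrow> real ^ 'n \<Rightarrow> real ^ 'n ^ 'n" where
  "metric_cofactor \<Theta> \<xi> =
     transpose (det (metric_jacobian \<Theta> \<xi>) *\<^sub>R matrix_inv (metric_jacobian \<Theta> \<xi>))"

definition element_mapping :: "(real ^ 'n \<Rightarrow> real ^ 'n) \<Rightarrow> bool" where
  "element_mapping \<Theta> \<longleftrightarrow>
     inj_on \<Theta> ref_element \<and>
     \<Theta> differentiable_on ref_element \<and>
     continuous_on ref_element (metric_jacobian \<Theta>) \<and>
     (\<forall>\<xi>\<in>ref_element. det (metric_jacobian \<Theta> \<xi>) \<noteq> 0)"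

definition mesh :: "(real ^ 'n) set \<Rightarrow> 'm set \<Rightarrow> ('m \<Rightarrow> real ^ 'n \<Rightarrow> real ^ 'n) \<Rightarrow> bool" where
  "mesh \<Omega> M \<Theta> \<longleftrightarrow>
     finite M \<and>
     (\<forall>m\<in>M. element_mapping (\<Theta> m)) \<and>
     \<Omega> = (\<Union>m\<in>M. \<Theta> m ` ref_element) \<and>
     disjoint_family_on (\<lambda>m. interior (\<Theta> m ` ref_element)) M"

text \<open>A ``linear'' mapping may include a translation of the element.\<close>

definition linear_mapping :: "(real ^ 'n \<Rightarrow> real ^ 'n) \<Rightarrow> bool" where
  "linear_mapping \<Theta> \<longleftrightarrow> (\<exists>A b. \<forall>\<xi>\<in>ref_element. \<Theta> \<xi> = A *v \<xi> + b)"

subsection \<open>Polynomial basis, projection and discrete solution\<close>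

definition poly_basis :: "nat \<Rightarrow> (nat \<Rightarrow> real poly) \<Rightarrow> bool" where
  "poly_basis p l \<longleftrightarrow>
     (\<forall>a\<le>p. degree (l a) \<le> p) \<and>
     (\<forall>c. (\<Sum>a\<le>p. smult (c a) (l a)) = 0 \<longrightarrow> (\<forall>a\<le>p. c a = 0)) \<and>
     (\<forall>q. degree q \<le> p \<longrightarrow> (\<exists>c. q = (\<Sum>a\<le>p. smult (c a) (l a))))"

text \<open>The functions \<open>\<phi> 1, \<dots>, \<phi> N\<close>, with \<open>N = (p + 1)\<^sup>d\<close>, are the products of one-dimensional
  basis polynomials \<open>l k a\<close> (direction \<open>k\<close>, number \<open>a \<le> p\<close>), enumerated by an arbitrary
  bijection \<open>s\<close> onto the multi-indices. The one-dimensional bases may be modal or nodal.\<close>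

definition num_basis :: "'n itself \<Rightarrow> nat \<Rightarrow> nat" where
  "num_basis _ p = (p + 1) ^ CARD('n)"

definition tensor_basis :: "nat \<Rightarrow> (nat \<Rightarrow> real ^ 'n \<Rightarrow> real) \<Rightarrow> bool" where
  "tensor_basis p \<phi> \<longleftrightarrow>
     (\<exists>(l :: 'n \<Rightarrow> nat \<Rightarrow> real poly) (s :: nat \<Rightarrow> 'n \<Rightarrow> nat).
        (\<forall>k. poly_basis p (l k)) \<and>
        bij_betw s {1..num_basis TYPE('n) p} {\<alpha>. \<forall>k. \<alpha> k \<le> p} \<and>
        (\<forall>i\<in>{1..num_basis TYPE('n) p}. \<forall>\<xi>. \<phi> i \<xi> = (\<Prod>k\<in>UNIV. poly (l k (s i k)) (\<xi> $ k))))"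

definition expansion :: "nat \<Rightarrow> (nat \<Rightarrow> real ^ 'n \<Rightarrow> real) \<Rightarrow> (nat \<Rightarrow> real) \<Rightarrow> real ^ 'n \<Rightarrow> real" where
  "expansion p \<phi> c \<xi> = (\<Sum>j = 1..num_basis TYPE('n) p. \<phi> j \<xi> * c j)"

text \<open>Coefficients of the \<open>L\<^sub>2\<close> projection on the reference element, characterized by
  orthogonality of the residual to the basis. Indices outside \<open>{1..N}\<close> carry no meaning
  and are set to zero to make the coefficient function unique.\<close>

definition L2_proj ::
  "nat \<Rightarrow> (nat \<Rightarrow> real ^ 'n \<Rightarrow> real) \<Rightarrow> (real ^ 'n \<Rightarrow> real) \<Rightarrow> nat \<Rightarrow> real" where
  "L2_proj p \<phi> g = (THE c.
     (\<forall>i\<in>{1..num_basis TYPE('n) p}.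
        integral ref_element (\<lambda>\<xi>. \<phi> i \<xi> * (g \<xi> - expansion p \<phi> c \<xi>)) = 0) \<and>
     (\<forall>j. j \<notin> {1..num_basis TYPE('n) p} \<longrightarrow> c j = 0))"

definition L2_proj_vec ::
  "nat \<Rightarrow> (nat \<Rightarrow> real ^ 'n \<Rightarrow> real) \<Rightarrow> (real ^ 'n \<Rightarrow> real ^ 'n) \<Rightarrow> nat \<Rightarrow> real ^ 'n" where
  "L2_proj_vec p \<phi> F j = (\<chi> k. L2_proj p \<phi> (\<lambda>\<xi>. F \<xi> $ k) j)"

definition ref_gradient :: "(real ^ 'n \<Rightarrow> real) \<Rightarrow> real ^ 'n \<Rightarrow> real ^ 'n" where
  "ref_gradient g \<xi> = (\<chi> k. frechet_derivative g (at \<xi>) (axis k 1))"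

subsection \<open>Volume terms\<close>

text \<open>The arguments are the order \<open>p\<close>, the basis \<open>\<phi>\<close>, the element mapping \<open>\<Theta>\<close>,
  the flux \<open>f\<close>, the coefficients \<open>u\<close> of the discrete solution, and the index \<open>i\<close>.\<close>

definition conservative_volume_term ::
  "nat \<Rightarrow> (nat \<Rightarrow> real ^ 'n \<Rightarrow> real) \<Rightarrow> (real ^ 'n \<Rightarrow> real ^ 'n) \<Rightarrow>
   (real \<Rightarrow> real ^ 'n) \<Rightarrow> (nat \<Rightarrow> real) \<Rightarrow> nat \<Rightarrow> real" where
  "conservative_volume_term p \<phi> \<Theta> f u i =
     integral ref_element (\<lambda>\<xi>. \<phi> i \<xi> *
       (\<Sum>j = 1..num_basis TYPE('n) p.
          ref_gradient (\<phi> j) \<xi> \<bullet>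
          L2_proj_vec p \<phi> (\<lambda>\<eta>. f (expansion p \<phi> u \<eta>) v* metric_cofactor \<Theta> \<eta>) j))"

definition nonconservative_volume_term ::
  "nat \<Rightarrow> (nat \<Rightarrow> real ^ 'n \<Rightarrow> real) \<Rightarrow> (real ^ 'n \<Rightarrow> real ^ 'n) \<Rightarrow>
   (real \<Rightarrow> real ^ 'n) \<Rightarrow> (nat \<Rightarrow> real) \<Rightarrow> nat \<Rightarrow> real" where
  "nonconservative_volume_term p \<phi> \<Theta> f u i =
     integral ref_element (\<lambda>\<xi>. \<phi> i \<xi> *
       (\<Sum>j = 1..num_basis TYPE('n) p.
          (ref_gradient (\<phi> j) \<xi> v* transpose (metric_cofactor \<Theta> \<xi>)) \<bullet>
          L2_proj_vec p \<phi> (\<lambda>\<eta>. f (expansion p \<phi> u \<eta>)) j))"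

end

theory Submission
  imports Defs
begin

text \<open>
  Suppose that the two volume terms agree for every flux and every discrete solution; then
  every metric cofactor \<open>C $ n $ k\<close> is constant on the reference cube, and this makes the element
  mapping affine.

  Take a flux with the single component \<open>n\<close>, and let \<open>E = f(u)\<close>. Tested with a tensor-product
  polynomial \<open>v\<close>, the conservative term is \<open>\<Sum>k. \<langle>v, \<partial>\<^sub>k \<Pi>(E C $ n $ k)\<rangle>\<close>, while the
  non-conservative term is a linear functional of \<open>\<Pi> E\<close>, hence of the form \<open>\<langle>w, E\<rangle>\<close> with \<open>w\<close> in
  the polynomial space. The test function \<open>v\<close> is the product of the Legendre polynomial of degree
  \<open>p - 1\<close> in direction \<open>k0\<close> and those of degree \<open>p\<close> in all other directions. The latter are
  orthogonal to derivatives, so that only the summand \<open>k = k0\<close> survives. In direction \<open>k0\<close>, pairing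
  a derivative with degree \<open>p - 1\<close> and pairing the function itself with degree \<open>p\<close> both read off the
  leading coefficient, up to a factor
  (\<open>rodrigues_derivative_adjoint\<close>). So the conservative term is a nonzero multiple of
  \<open>\<langle>\<Psi>, E C $ n $ k0\<rangle>\<close>, where \<open>\<Psi>\<close> is the product of the Legendre polynomials of degree \<open>p\<close> in all
  directions, and agreement means that \<open>\<Psi> C $ n $ k0 - w\<close> (with \<open>w\<close> rescaled) is orthogonal to \<open>E\<close>
  (\<open>volume_terms_agree_imp\<close>).

  As \<open>p \<ge> 1\<close>, the discrete solution can be any linear form, and with the exponential as flux
  function \<open>E\<close> ranges over all \<open>exp (a \<bullet> \<xi>)\<close>. Their span is dense by the Stone-Weierstrass theorem
  (\<open>orthogonal_to_exponentials_imp_zero\<close>), so \<open>\<Psi> C $ n $ k0 = w\<close> pointwise on the cube.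

  The Legendre polynomial of degree \<open>p\<close> has \<open>p\<close> distinct roots inside the interval. On a line
  parallel to an axis, \<open>w\<close> has degree at most \<open>p\<close> and vanishes at all of them, so it is a multiple of
  this Legendre polynomial there and the quotient is constant along the line. Changing one
  coordinate at a time and using continuity gives that \<open>C $ n $ k0\<close> is constant on the cube
  (\<open>tensor_poly_quotient_constant\<close>).

  Finally \<open>det C = (det J)\<^sup>d\<^sup>-\<^sup>1\<close> for the metric Jacobian matrix \<open>J\<close>. Because \<open>d \<ge> 2\<close>, a constant \<open>C\<close>
  forces \<open>\<bar>det J\<bar>\<close>, then by connectedness \<open>det J\<close>, and then \<open>J\<close> itself to be constant
  (\<open>constant_metric_cofactor_imp_linear\<close>).

  The projection is handled through a tensor-product basis dual to the given one:
  the \<open>j\<close>th coefficient of a projection is the inner product with the \<open>j\<close>th dual basis function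
  (\<open>L2_proj_eq_dual_inner\<close>).
\<close>

section \<open>Legendre polynomials via Rodrigues' formula\<close>

text \<open>Rolle's theorem between consecutive roots: induction removes the largest root, and the interval
  that is cut off contributes one more root of the derivative. The bounds by \<open>Min\<close> and \<open>Max\<close> keep the new roots
  strictly inside, so that boundary roots can be added again before the next differentiation.\<close>

lemma rolle_finite_roots:
  fixes q :: "real poly"
  assumes "finite S" "card S = Suc m" "\<forall>x\<in>S. poly q x = 0"
  shows "\<exists>T. finite T \<and> card T = m \<and> (\<forall>x\<in>T. poly (pderiv q) x = 0 \<and> Min S < x \<and> x < Max S)"
  using assms
proof (induction m arbitrary: S)
  case 0
  then show ?case by (intro exI[of _ "{}"]) auto
next
  case (Suc m)
  define b where "b = Max S"
  define S' where "S' = S - {b}"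
  have ne: "S \<noteq> {}" using Suc.prems by auto
  have bS: "b \<in> S" using Suc.prems ne by (simp add: b_def)
  have S': "finite S'" "card S' = Suc m" "S' \<noteq> {}" "S' \<subseteq> S"
  proof -
    show 1: "finite S'" "card S' = Suc m" using Suc.prems bS by (simp_all add: S'_def card_Diff_singleton)
    then show "S' \<noteq> {}" by auto
    show "S' \<subseteq> S" by (auto simp: S'_def)
  qed
  obtain T where T: "finite T" "card T = m"
      "\<forall>x\<in>T. poly (pderiv q) x = 0 \<and> Min S' < x \<and> x < Max S'"
    using Suc.IH[OF S'(1,2)] Suc.prems S'(4) by blast
  have a: "Max S' \<in> S'" using S' by simp
  have ab: "Max S' < b"
    using Max_ge[OF Suc.prems(1), of "Max S'"] a S'(4) by (auto simp: S'_def b_def)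
  have "poly q (Max S') = 0" "poly q b = 0"
    using a S'(4) bS Suc.prems(3) by auto
  then obtain z where z: "Max S' < z" "z < b" "poly (pderiv q) z = 0"
    using poly_MVT[OF ab, of q] ab by auto
  have "Min S \<le> Min S'" using S' Suc.prems(1) by (meson Min_antimono)
  moreover have "Min S' \<le> Max S'" using S' by simp
  ultimately have "\<forall>x\<in>insert z T. poly (pderiv q) x = 0 \<and> Min S < x \<and> x < Max S"
    using T(3) z ab unfolding b_def by fastforce
  moreover have "z \<notin> T" using T(3) z by auto
  ultimately show ?case
    using T(1,2) by (intro exI[of _ "insert z T"]) auto
qed

text \<open>A nonzero multiple of the Legendre polynomial of degree \<open>n\<close>. Only orthogonality and the location of
  the roots matter, so the customary normalization is dropped.\<close>

definition rodrigues :: "nat \<Rightarrow> real poly" where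
  "rodrigues n = (pderiv ^^ n) ([:1, 0, -1:] ^ n)"

lemma power_dvd_pderiv:
  fixes a q :: "real poly"
  assumes "a ^ Suc m dvd q"
  shows "a ^ m dvd pderiv q"
proof -
  obtain r where r: "q = a ^ Suc m * r" using assms by (elim dvdE)
  have "pderiv q = a ^ m * (a * pderiv r + smult (of_nat (Suc m)) (pderiv a * r))"
    unfolding r pderiv_mult pderiv_power_Suc by (simp add: algebra_simps)
  then show ?thesis by simp
qed

lemma power_dvd_pderiv_funpow:
  assumes "k \<le> n"
  shows "([:1, 0, -1:] :: real poly) ^ (n - k) dvd (pderiv ^^ k) ([:1, 0, -1:] ^ n)"
  using assms
proof (induction k)
  case (Suc k)
  then have "n - k = Suc (n - Suc k)" by simp
  then have "([:1, 0, -1:] :: real poly) ^ Suc (n - Suc k) dvd (pderiv ^^ k) ([:1, 0, -1:] ^ n)"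
    using Suc by simp
  then show ?case by (simp add: power_dvd_pderiv del: power_Suc)
qed simp

lemma rodrigues_boundary:
  assumes "k < n" "x = 1 \<or> x = -1"
  shows "poly ((pderiv ^^ k) ([:1, 0, -1:] ^ n)) (x::real) = 0"
proof -
  have "([:1, 0, -1:] :: real poly) dvd [:1, 0, -1:] ^ (n - k)"
    using assms by (intro dvd_power) simp
  also have "\<dots> dvd (pderiv ^^ k) ([:1, 0, -1:] ^ n)"
    using assms by (intro power_dvd_pderiv_funpow) simp
  finally obtain r :: "real poly" where r: "(pderiv ^^ k) ([:1, 0, -1:] ^ n) = [:1, 0, -1:] * r"
    unfolding dvd_def by blast
  show ?thesis unfolding r poly_mult using assms(2) by auto
qed

text \<open>Each derivative of order below \<open>n\<close> of \<open>(1 - x\<^sup>2)\<^sup>n\<close> still vanishes at both endpoints, so Rolle's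
  theorem gains one interior root per differentiation.\<close>

lemma rodrigues_roots:
  "\<exists>T. finite T \<and> card T = n \<and> T \<subseteq> {-1<..<1} \<and> (\<forall>x\<in>T. poly (rodrigues n) x = 0)"
proof -
  have "k \<le> n \<Longrightarrow> \<exists>T. finite T \<and> card T = k \<and> T \<subseteq> {-1<..<1} \<and>
          (\<forall>x\<in>T. poly ((pderiv ^^ k) ([:1, 0, -1:] ^ n)) (x::real) = 0)" for k
  proof (induction k)
    case 0
    show ?case by (intro exI[of _ "{}"]) auto
  next
    case (Suc k)
    then obtain T where T: "finite T" "card T = k" "T \<subseteq> {-1<..<1}"
       "\<forall>x\<in>T. poly ((pderiv ^^ k) ([:1, 0, -1:] ^ n)) (x::real) = 0" by auto
    \<comment> \<open>Two boundary roots are added and one root is lost, a net gain of one.\<close>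
    define S where "S = insert (-1) (insert 1 T)"
    have S: "finite S" "card S = Suc (Suc k)"
    proof -
      have "1 \<notin> T" "-1 \<notin> insert 1 T" using T(3) by auto
      then show "finite S" "card S = Suc (Suc k)" using T(1,2) by (simp_all add: S_def)
    qed
    have "\<forall>x\<in>S. poly ((pderiv ^^ k) ([:1, 0, -1:] ^ n)) (x::real) = 0"
      using T(4) rodrigues_boundary[of k n] Suc.prems by (auto simp: S_def)
    from rolle_finite_roots[OF S this] obtain U where U: "finite U" "card U = Suc k"
      "\<forall>x\<in>U. poly (pderiv ((pderiv ^^ k) ([:1, 0, -1:] ^ n))) x = 0 \<and> Min S < x \<and> x < Max S"
      by blast
    have "Min S = -1" unfolding S_def using T by (intro Min_eqI) (auto simp: subset_iff less_imp_le)
    moreover have "Max S = 1" unfolding S_def using T by (intro Max_eqI) (auto simp: subset_iff less_imp_le)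
    ultimately show ?case using U by (intro exI[of _ U]) auto
  qed
  from this[of n] show ?thesis by (simp add: rodrigues_def)
qed

definition poly_integral :: "real poly \<Rightarrow> real" where
  "poly_integral q = integral {-1..1} (poly q)"

lemma poly_integrable: "poly (q :: real poly) integrable_on {a..b}"
  by (intro integrable_continuous_real continuous_intros)

lemma poly_integral_linear:
  "poly_integral 0 = 0"
  "poly_integral (q + r) = poly_integral q + poly_integral r"
  "poly_integral (q - r) = poly_integral q - poly_integral r"
  "poly_integral (- q) = - poly_integral q"
  "poly_integral (smult c q) = c * poly_integral q"
proof -
  have "poly (0 :: real poly) = (\<lambda>x. 0)" "poly (q + r) = (\<lambda>x. poly q x + poly r x)"
    "poly (q - r) = (\<lambda>x. poly q x - poly r x)" "poly (- q) = (\<lambda>x. - poly q x)"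
    "poly (smult c q) = (\<lambda>x. c * poly q x)" by auto
  then show "poly_integral 0 = 0"
    "poly_integral (q + r) = poly_integral q + poly_integral r"
    "poly_integral (q - r) = poly_integral q - poly_integral r"
    "poly_integral (- q) = - poly_integral q"
    "poly_integral (smult c q) = c * poly_integral q"
    by (simp_all add: poly_integral_def integral_add integral_diff poly_integrable)
qed

lemma poly_integral_sum: "poly_integral (\<Sum>i\<in>I. g i) = (\<Sum>i\<in>I. poly_integral (g i))"
  by (induction I rule: infinite_finite_induct) (simp_all add: poly_integral_linear)

lemma poly_integral_pderiv: "poly_integral (pderiv q) = poly q 1 - poly q (-1)"
proof -
  have "(poly (pderiv q) has_integral (poly q 1 - poly q (-1))) {-1..1}"
    by (intro fundamental_theorem_of_calculus)
       (simp_all add: has_real_derivative_iff_has_vector_derivative[symmetric] poly_DERIV has_field_derivative_at_within)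
  then show ?thesis by (simp add: poly_integral_def integral_unique)
qed

lemma poly_integral_zero_imp:
  assumes "\<And>x. -1 \<le> x \<Longrightarrow> x \<le> 1 \<Longrightarrow> poly q x \<ge> 0" "poly_integral q = 0"
  shows "q = 0"
proof -
  have "\<forall>x\<in>{-1..1}. poly q x = 0"
    using assms integral_cbox_eq_0_iff[of "-1" 1 "poly q"]
    by (simp add: poly_integral_def continuous_on_poly)
  then have sub: "{-1..1} \<subseteq> {x. poly q x = 0}" by auto
  have "infinite {-1..1::real}" by (rule infinite_Icc) simp
  then have "infinite {x. poly q x = 0}" using sub finite_subset by blast
  then show ?thesis using poly_roots_finite by blast
qed

lemma poly_integral_nonneg:
  assumes "\<And>x. -1 \<le> x \<Longrightarrow> x \<le> 1 \<Longrightarrow> poly q x \<ge> 0"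
  shows "poly_integral q \<ge> 0"
  unfolding poly_integral_def using assms by (intro integral_nonneg poly_integrable) auto

lemma poly_integral_square: "poly_integral (q * q) \<ge> 0" "poly_integral (q * q) = 0 \<Longrightarrow> q = 0"
  using poly_integral_zero_imp[of "q * q"] by (auto intro: poly_integral_nonneg)

text \<open>Integration by parts, without boundary terms because of the zeros at the endpoints.\<close>

lemma poly_integral_rodrigues_parts:
  assumes "k \<le> n"
  shows "poly_integral ((pderiv ^^ k) ([:1, 0, -1:] ^ n) * w) =
     (-1) ^ k * poly_integral ([:1, 0, -1:] ^ n * (pderiv ^^ k) w)"
  using assms
proof (induction k arbitrary: w)
  case (Suc k)
  let ?D = "(pderiv ^^ k) ([:1, 0, -1:] ^ n)"
  have "poly_integral (pderiv (?D * w)) = 0"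
    using Suc.prems by (subst poly_integral_pderiv) (simp add: rodrigues_boundary)
  then have "poly_integral (pderiv ?D * w) = - poly_integral (?D * pderiv w)"
    by (simp add: pderiv_mult poly_integral_linear mult.commute)
  also have "\<dots> = (-1) ^ Suc k * poly_integral ([:1, 0, -1:] ^ n * (pderiv ^^ Suc k) w)"
    using Suc by (simp add: funpow_swap1)
  finally show ?case by simp
qed simp

lemma pderiv_funpow_degree_le:
  fixes w :: "real poly"
  assumes "degree w \<le> n"
  shows "(pderiv ^^ n) w = [:fact n * coeff w n:]"
  using assms
proof (induction n arbitrary: w)
  case 0
  then show ?case by (auto elim: degree_eq_zeroE)
next
  case (Suc n)
  have "degree (pderiv w) \<le> n" using Suc.prems by (simp add: degree_pderiv)
  from Suc.IH[OF this] show ?case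
    by (simp add: funpow_Suc_right coeff_pderiv algebra_simps del: funpow.simps)
qed

text \<open>Moving all \<open>n\<close> derivatives onto \<open>w\<close> leaves only its coefficient of degree \<open>n\<close>: up to a factor, the
  Legendre polynomial represents the functional that reads off this coefficient.\<close>

lemma poly_integral_rodrigues:
  assumes "degree w \<le> n"
  shows "poly_integral (rodrigues n * w) =
    (-1) ^ n * fact n * coeff w n * poly_integral ([:1, 0, -1:] ^ n)"
  using poly_integral_rodrigues_parts[of n n w] pderiv_funpow_degree_le[OF assms]
  by (simp add: rodrigues_def poly_integral_linear)

lemma poly_integral_weight_nonzero: "poly_integral ([:1, 0, -1:] ^ n) \<noteq> 0"
proof
  assume "poly_integral ([:1, 0, -1:] ^ n) = 0"
  moreover have "poly ([:1, 0, -1:] ^ n) x \<ge> 0" if "-1 \<le> x" "x \<le> 1" for x :: real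
  proof -
    have "0 \<le> (1 - x) * (1 + x)" using that by (intro mult_nonneg_nonneg) auto
    then have "0 \<le> poly [:1, 0, -1:] x" by (simp add: algebra_simps)
    then show ?thesis unfolding poly_power by (rule zero_le_power)
  qed
  ultimately have "[:1, 0, -1:] ^ n = (0 :: real poly)" by (intro poly_integral_zero_imp) 
  then show False by simp
qed

text \<open>Both sides are nonzero multiples of the coefficient of degree \<open>p\<close> of \<open>w\<close>. This is what lets a
  derivative under the projection be traded for multiplication with a Legendre polynomial.\<close>

lemma rodrigues_derivative_adjoint:
  assumes "p \<ge> 1"
  obtains \<kappa> where "\<kappa> \<noteq> 0"
    "\<And>w. degree w \<le> p \<Longrightarrow>
        poly_integral (rodrigues (p - 1) * pderiv w) = \<kappa> * poly_integral (rodrigues p * w)"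
proof
  let ?I = "\<lambda>n. poly_integral ([:1, 0, -1:] ^ n)"
  show "- ?I (p - 1) / ?I p \<noteq> 0" using poly_integral_weight_nonzero by simp
  fix w :: "real poly" assume w: "degree w \<le> p"
  obtain n where p: "p = Suc n" using assms by (cases p) auto
  have "degree (pderiv w) \<le> n" using w p by (simp add: degree_pderiv)
  from poly_integral_rodrigues[OF this] poly_integral_rodrigues[OF w]
  show "poly_integral (rodrigues (p - 1) * pderiv w)
      = - ?I (p - 1) / ?I p * poly_integral (rodrigues p * w)"
    using poly_integral_weight_nonzero[of "Suc n"]
    unfolding p by (simp add: coeff_pderiv del: power_Suc) (simp add: power_Suc2)
qed

lemma rodrigues_orthogonal_pderiv:
  assumes "degree w \<le> p"
  shows "poly_integral (rodrigues p * pderiv w) = 0"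
proof -
  have "degree (pderiv w) \<le> p" "coeff (pderiv w) p = 0"
    using assms by (auto simp: degree_pderiv coeff_pderiv intro!: coeff_eq_0)
  then show ?thesis using poly_integral_rodrigues[of "pderiv w" p] by simp
qed

lemma degree_rodrigues: "degree (rodrigues n) = n"
proof -
  have "degree ((pderiv ^^ k) q) = degree q - k" for k and q :: "real poly"
    by (induction k) (simp_all add: degree_pderiv)
  then show ?thesis by (simp add: rodrigues_def degree_power_eq)
qed

lemma rodrigues_nonzero: "rodrigues n \<noteq> 0"
proof
  assume "rodrigues n = 0"
  then show False
    using poly_integral_rodrigues[of "monom 1 n" n] poly_integral_weight_nonzero[of n]
    by (simp add: degree_monom_le poly_integral_linear)
qed

text \<open>Subtracting the multiple with the same leading coefficient leaves a polynomial of degree less than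
  \<open>n\<close> with the \<open>n\<close> distinct roots of the Legendre polynomial, so nothing remains.\<close>

lemma multiple_of_rodrigues:
  assumes "degree h \<le> n" "\<And>x. -1 \<le> x \<Longrightarrow> x \<le> 1 \<Longrightarrow> poly (rodrigues n) x = 0 \<Longrightarrow> poly h x = 0"
  shows "\<exists>a. h = smult a (rodrigues n)"
proof -
  define a where "a = coeff h n / coeff (rodrigues n) n"
  define r where "r = h - smult a (rodrigues n)"
  have lc: "coeff (rodrigues n) n \<noteq> 0"
    using rodrigues_nonzero[of n] degree_rodrigues[of n] by (metis leading_coeff_0_iff)
  have cr: "coeff r n = 0" using lc by (simp add: r_def a_def)
  have dr: "degree r \<le> n" using assms(1) degree_rodrigues[of n]
    by (auto simp: r_def intro!: degree_diff_le order.trans[OF degree_smult_le])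
  obtain T where T: "finite T" "card T = n" "T \<subseteq> {-1<..<1}" "\<forall>x\<in>T. poly (rodrigues n) x = 0"
    using rodrigues_roots by blast
  have "r = 0"
  proof (rule ccontr)
    assume nz: "r \<noteq> 0"
    have "degree r < n" using dr cr nz by (metis le_neq_implies_less leading_coeff_0_iff)
    moreover have "T \<subseteq> {x. poly r x = 0}"
    proof
      fix x assume "x \<in> T"
      then have "-1 \<le> x" "x \<le> 1" "poly (rodrigues n) x = 0" using T by (auto simp: subset_iff less_imp_le)
      then show "x \<in> {x. poly r x = 0}" using assms(2)[of x] by (simp add: r_def)
    qed
    then have "n \<le> card {x. poly r x = 0}" using T(2) card_mono[OF poly_roots_finite[OF nz]] by blast
    ultimately show False using card_poly_roots_bound[OF nz] by linarith
  qed
  then show ?thesis unfolding r_def by (intro exI[of _ a]) simp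
qed

section \<open>Dual bases of univariate polynomials\<close>

text \<open>Gram matrices are solvable. In the induction step, \<open>e\<close> holds the coefficients of the projection of the
  new vector \<open>k\<close> onto the old ones, and the Schur complement \<open>s\<close> is the value of the form on the
  difference; it is nonzero since the form is anisotropic.\<close>

lemma symmetric_anisotropic_solvable:
  fixes G :: "'i \<Rightarrow> 'i \<Rightarrow> real"
  assumes "finite I" "\<And>i j. i \<in> I \<Longrightarrow> j \<in> I \<Longrightarrow> G i j = G j i"
    and "\<And>c. (\<Sum>i\<in>I. \<Sum>j\<in>I. c i * c j * G i j) = 0 \<Longrightarrow> \<forall>i\<in>I. c i = 0"
  shows "\<exists>c. \<forall>i\<in>I. (\<Sum>j\<in>I. G i j * c j) = b i"
  using assms
proof (induction I arbitrary: b rule: finite_induct)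
  case (insert k I)
  have sym: "G i j = G j i" if "i \<in> insert k I" "j \<in> insert k I" for i j
    using insert.prems(1) that by blast
  have IH: "\<exists>c. \<forall>i\<in>I. (\<Sum>j\<in>I. G i j * c j) = b i" for b
  proof (rule insert.IH)
    show "G i j = G j i" if "i \<in> I" "j \<in> I" for i j using sym that by simp
    fix c assume c: "(\<Sum>i\<in>I. \<Sum>j\<in>I. c i * c j * G i j) = 0"
    define c' where "c' = c(k := 0)"
    have eq: "\<And>i. i \<in> I \<Longrightarrow> c' i = c i" and "c' k = 0"
      using insert.hyps by (auto simp: c'_def)
    then have "(\<Sum>i\<in>insert k I. \<Sum>j\<in>insert k I. c' i * c' j * G i j) = 0"
      using c insert.hyps by (simp cong: sum.cong)
    then have "\<forall>i\<in>insert k I. c' i = 0" by (rule insert.prems(2))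
    then show "\<forall>i\<in>I. c i = 0" using eq by simp
  qed
  obtain e where e: "\<forall>i\<in>I. (\<Sum>j\<in>I. G i j * e j) = G i k" using IH[of "\<lambda>i. G i k"] by blast
  obtain c where c: "\<forall>i\<in>I. (\<Sum>j\<in>I. G i j * c j) = b i" using IH[of b] by blast
  define s where "s = G k k - (\<Sum>j\<in>I. G k j * e j)"
  have "s \<noteq> 0"
  proof
    assume s: "s = 0"
    \<comment> \<open>If the Schur complement vanishes, \<open>z\<close> lies in the kernel of the whole matrix.\<close>
    define z where "z = (\<lambda>i. if i = k then 1 else - e i)"
    have zI: "\<And>i. i \<in> I \<Longrightarrow> z i = - e i" and zk: "z k = 1" using insert.hyps by (auto simp: z_def)
    have row: "(\<Sum>j\<in>insert k I. G i j * z j) = 0" if "i \<in> insert k I" for i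
      using that insert.hyps e s by (auto simp: zI zk s_def sum_negf cong: sum.cong)
    have "(\<Sum>i\<in>insert k I. \<Sum>j\<in>insert k I. z i * z j * G i j)
        = (\<Sum>i\<in>insert k I. z i * (\<Sum>j\<in>insert k I. G i j * z j))"
      by (simp only: sum_distrib_left mult_ac)
    also have "\<dots> = 0" using row by (intro sum.neutral) simp
    finally have "\<forall>i\<in>insert k I. z i = 0" by (rule insert.prems(2))
    then show False using zk by simp
  qed
  define t where "t = (b k - (\<Sum>j\<in>I. G k j * c j)) / s"
  define x where "x = (\<lambda>i. if i = k then t else c i - t * e i)"
  have xI: "\<And>i. i \<in> I \<Longrightarrow> x i = c i - t * e i" and xk: "x k = t" using insert.hyps by (auto simp: x_def)
  have sm: "(\<Sum>j\<in>insert k I. G i j * x j)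
      = G i k * t + (\<Sum>j\<in>I. G i j * c j) - t * (\<Sum>j\<in>I. G i j * e j)" for i
    using insert.hyps
    by (simp add: xI xk algebra_simps sum_subtractf sum_distrib_left cong: sum.cong)
  have "(\<Sum>j\<in>insert k I. G i j * x j) = b i" if i: "i \<in> insert k I" for i
  proof (cases "i = k")
    case True
    have "(\<Sum>j\<in>insert k I. G k j * x j) = t * s + (\<Sum>j\<in>I. G k j * c j)"
      unfolding sm s_def by (simp add: algebra_simps)
    then show ?thesis using True \<open>s \<noteq> 0\<close> by (simp add: t_def)
  next
    case False
    then show ?thesis using i e c unfolding sm by simp
  qed
  then show ?case by blast
qed simp

lemma degree_sum_smult_le:
  assumes "\<And>a. a \<in> A \<Longrightarrow> degree (l a) \<le> p"
  shows "degree (\<Sum>a\<in>A. smult (c a) (l a)) \<le> p"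
proof (cases "finite A")
  case True
  then show ?thesis
    using assms by (intro degree_sum_le) (auto intro: order.trans[OF degree_smult_le])
qed simp

text \<open>The rows of the inverse Gram matrix are the coefficients of the dual basis.\<close>

lemma poly_basis_dual:
  assumes "poly_basis p l"
  obtains l' where "\<And>b. b \<le> p \<Longrightarrow> degree (l' b) \<le> p"
    "\<And>a b. a \<le> p \<Longrightarrow> b \<le> p \<Longrightarrow> poly_integral (l a * l' b) = (if a = b then 1 else 0)"
proof -
  define G where "G = (\<lambda>i j. poly_integral (l i * l j))"
  have "\<exists>c. \<forall>i\<in>{..p}. (\<Sum>j\<le>p. G i j * c j) = (if i = b then 1 else 0)" for b
  proof (rule symmetric_anisotropic_solvable)
    show "G i j = G j i" for i j by (simp add: G_def mult.commute)
    fix c assume c: "(\<Sum>i\<le>p. \<Sum>j\<le>p. c i * c j * G i j) = 0"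
    let ?q = "\<Sum>i\<le>p. smult (c i) (l i)"
    have "poly_integral (?q * ?q) = (\<Sum>i\<le>p. \<Sum>j\<le>p. c i * c j * G i j)"
      by (simp add: sum_product poly_integral_sum poly_integral_linear G_def mult_ac)
    with c have "?q = 0" using poly_integral_square(2) by simp
    then show "\<forall>i\<in>{..p}. c i = 0" using assms unfolding poly_basis_def by blast
  qed simp
  then obtain c where c: "\<And>b i. i \<le> p \<Longrightarrow> (\<Sum>j\<le>p. G i j * c b j) = (if i = b then 1 else 0)"
    by (metis atMost_iff)
  show ?thesis
  proof (rule that[of "\<lambda>b. \<Sum>j\<le>p. smult (c b j) (l j)"])
    show "degree (\<Sum>j\<le>p. smult (c b j) (l j)) \<le> p" for b
      using assms by (intro degree_sum_smult_le) (auto simp: poly_basis_def)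
    show "poly_integral (l a * (\<Sum>j\<le>p. smult (c b j) (l j))) = (if a = b then 1 else 0)"
      if "a \<le> p" for a b
      using c[OF that, of b]
      by (simp add: sum_distrib_left poly_integral_sum poly_integral_linear G_def mult_ac)
  qed
qed

text \<open>The remainder of the expansion is orthogonal to every \<open>l a\<close>, hence to itself. In particular
  the dual basis spans the same polynomial space.\<close>

lemma dual_basis_expansion:
  assumes "poly_basis p l" "\<And>b. b \<le> p \<Longrightarrow> degree (l' b) \<le> p"
    "\<And>a b. a \<le> p \<Longrightarrow> b \<le> p \<Longrightarrow> poly_integral (l a * l' b) = (if a = b then 1 else 0)"
    "degree q \<le> p"
  shows "q = (\<Sum>b\<le>p. smult (poly_integral (q * l b)) (l' b))"
proof -
  define r where "r = q - (\<Sum>b\<le>p. smult (poly_integral (q * l b)) (l' b))"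
  have "degree r \<le> p" unfolding r_def
    by (intro degree_diff_le assms degree_sum_smult_le) auto
  then obtain c where c: "r = (\<Sum>a\<le>p. smult (c a) (l a))"
    using assms(1) unfolding poly_basis_def by blast
  have orth: "poly_integral (l a * r) = 0" if "a \<le> p" for a
  proof -
    have "poly_integral (l a * r) = poly_integral (l a * q)
        - (\<Sum>b\<le>p. poly_integral (q * l b) * poly_integral (l a * l' b))"
      by (simp add: r_def right_diff_distrib sum_distrib_left poly_integral_sum poly_integral_linear)
    also have "(\<Sum>b\<le>p. poly_integral (q * l b) * poly_integral (l a * l' b))
        = (\<Sum>b\<le>p. if b = a then poly_integral (q * l b) else 0)"
      using that assms(3) by (intro sum.cong) auto
    also have "\<dots> = poly_integral (l a * q)" using that by (simp add: mult.commute)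
    finally show ?thesis by simp
  qed
  have "poly_integral (r * r) = (\<Sum>a\<le>p. c a * poly_integral (l a * r))"
    by (subst (1) c) (simp add: sum_distrib_right poly_integral_sum poly_integral_linear)
  also have "\<dots> = 0" using orth by simp
  finally have "r = 0" by (rule poly_integral_square(2))
  then show ?thesis by (simp add: r_def)
qed

section \<open>Integrating tensor products over the reference cube\<close>

text \<open>Fubini's theorem for products of univariate functions, from the description of Lebesgue
  measure as a product over the coordinate axes.\<close>

lemma integral_lborel_prod:
  fixes f :: "'a::euclidean_space \<Rightarrow> real \<Rightarrow> real"
  assumes "\<And>b. b \<in> Basis \<Longrightarrow> integrable lborel (f b)"
  shows "(LINT x|lborel. (\<Prod>b\<in>Basis. f b (x \<bullet> b))) = (\<Prod>b\<in>Basis. (LINT x|lborel. f b x))"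
proof -
  interpret product_sigma_finite "\<lambda>_ :: 'a. lborel :: real measure" ..
  have [measurable]: "f b \<in> borel_measurable borel" if "b \<in> Basis" for b
    using assms[OF that] by auto
  have "(LINT x|lborel. (\<Prod>b\<in>Basis. f b (x \<bullet> b)))
      = (LINT x|distr (\<Pi>\<^sub>M b\<in>Basis. lborel) borel (\<lambda>f. \<Sum>b\<in>Basis. f b *\<^sub>R b). (\<Prod>b\<in>(Basis::'a set). f b (x \<bullet> b)))"
    by (subst lborel_eq) simp
  also have "\<dots> = (LINT x|(\<Pi>\<^sub>M b\<in>(Basis::'a set). lborel). (\<Prod>b\<in>Basis. f b (x b)))"
    by (subst integral_distr) (auto intro!: Bochner_Integration.integral_cong prod.cong simp: inner_sum_left inner_Basis if_distrib cong: if_cong)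
  also have "\<dots> = (\<Prod>b\<in>Basis. (LINT x|lborel. f b x))"
    using assms by (intro product_integral_prod) auto
  finally show ?thesis .
qed

lemma Basis_vec_axis: "(Basis :: (real ^ 'n) set) = range (\<lambda>k. axis k 1)"
  by (auto simp: Basis_vec_def)

lemma mem_ref_element: "\<xi> \<in> ref_element \<longleftrightarrow> (\<forall>k. -1 \<le> \<xi> $ k \<and> \<xi> $ k \<le> 1)"
  by (simp add: ref_element_def mem_box_cart)

lemma compact_ref_element: "compact ref_element"
  by (simp add: ref_element_def)

lemma integral_ref_element_prod:
  fixes h :: "'n::finite \<Rightarrow> real \<Rightarrow> real"
  assumes "\<And>k. continuous_on {-1..1} (h k)"
  shows "integral ref_element (\<lambda>\<xi>. \<Prod>k\<in>UNIV. h k (\<xi> $ k)) = (\<Prod>k\<in>UNIV. integral {-1..1} (h k))"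
proof -
  define g where "g = (\<lambda>b :: real ^ 'n. \<lambda>x. indicator {-1..1} x * h (axis_index b) x)"
  have set_int: "set_integrable lborel {-1..1} (h k)" for k
    by (intro borel_integrable_atLeastAtMost' assms)
  then have g_int: "integrable lborel (g b)" for b
    by (simp add: set_integrable_def g_def)
  have cont: "continuous_on ref_element (\<lambda>\<xi> :: real ^ 'n. h k (\<xi> $ k))" for k
    by (rule continuous_on_compose2[OF assms[of k]]) (auto simp: mem_ref_element intro!: continuous_intros)
  have cube_int: "set_integrable lborel ref_element (\<lambda>\<xi> :: real ^ 'n. \<Prod>k\<in>UNIV. h k (\<xi> $ k))"
    unfolding set_integrable_def
    by (intro borel_integrable_compact compact_ref_element continuous_intros cont)
  have pointwise: "indicator ref_element \<xi> *\<^sub>R (\<Prod>k\<in>UNIV. h k (\<xi> $ k)) = (\<Prod>b\<in>Basis. g b (\<xi> \<bullet> b))"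
    for \<xi> :: "real ^ 'n"
  proof -
    have ind: "indicator ref_element \<xi> = (\<Prod>k\<in>UNIV. indicator {-1..1} (\<xi> $ k) :: real)"
      by (auto simp: indicator_def mem_ref_element)
    show ?thesis
      unfolding ind g_def Basis_vec_axis
      by (subst prod.reindex) (auto simp: inj_on_def axis_eq_axis prod.distrib inner_axis)
  qed
  have "integral ref_element (\<lambda>\<xi>. \<Prod>k\<in>UNIV. h k (\<xi> $ k))
      = (LINT \<xi>|lborel. (\<Prod>b\<in>Basis. g b (\<xi> \<bullet> b)))"
    unfolding set_borel_integral_eq_integral(2)[OF cube_int, symmetric] set_lebesgue_integral_def pointwise ..
  also have "\<dots> = (\<Prod>b\<in>Basis. (LINT x|lborel. g b x))"
    by (intro integral_lborel_prod g_int)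
  also have "\<dots> = (\<Prod>k\<in>UNIV. (LINT x|lborel. g (axis k 1) x))"
    unfolding Basis_vec_axis by (subst prod.reindex) (auto simp: inj_on_def axis_eq_axis)
  also have "\<dots> = (\<Prod>k\<in>UNIV. integral {-1..1} (h k))"
    using set_borel_integral_eq_integral(2)[OF set_int]
    by (simp add: g_def set_lebesgue_integral_def)
  finally show ?thesis .
qed

definition tensor_poly :: "('n \<Rightarrow> real poly) \<Rightarrow> real ^ 'n \<Rightarrow> real" where
  "tensor_poly q \<xi> = (\<Prod>k\<in>UNIV. poly (q k) (\<xi> $ k))"

definition cube_inner :: "(real ^ 'n \<Rightarrow> real) \<Rightarrow> (real ^ 'n \<Rightarrow> real) \<Rightarrow> real" where
  "cube_inner g h = integral ref_element (\<lambda>\<xi>. g \<xi> * h \<xi>)"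

lemma continuous_on_tensor_poly [continuous_intros]: "continuous_on S (tensor_poly q)"
  unfolding tensor_poly_def [abs_def] by (intro continuous_intros)

lemma continuous_on_integrable:
  fixes g :: "real ^ 'n \<Rightarrow> real"
  shows "continuous_on ref_element g \<Longrightarrow> g integrable_on ref_element"
  unfolding ref_element_def by (rule integrable_continuous)

lemma cube_inner_commute: "cube_inner g h = cube_inner h g"
  by (simp add: cube_inner_def mult.commute)

lemma cube_inner_tensor_poly:
  "cube_inner (tensor_poly q) (tensor_poly r) = (\<Prod>k\<in>UNIV. poly_integral (q k * r k))"
proof -
  have "cube_inner (tensor_poly q) (tensor_poly r)
      = integral ref_element (\<lambda>\<xi>. \<Prod>k\<in>UNIV. poly (q k * r k) (\<xi> $ k))"
    by (simp add: cube_inner_def tensor_poly_def prod.distrib)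
  also have "\<dots> = (\<Prod>k\<in>UNIV. poly_integral (q k * r k))"
    unfolding poly_integral_def
    by (rule integral_ref_element_prod) (intro continuous_intros)
  finally show ?thesis .
qed

lemma cube_inner_sum_right:
  assumes "continuous_on ref_element g" "\<And>j. j \<in> J \<Longrightarrow> continuous_on ref_element (h j)"
  shows "cube_inner g (\<lambda>\<xi>. \<Sum>j\<in>J. h j \<xi>) = (\<Sum>j\<in>J. cube_inner g (h j))"
proof (cases "finite J")
  case True
  show ?thesis
    unfolding cube_inner_def sum_distrib_left
    by (intro integral_sum True continuous_on_integrable continuous_intros assms)
next
  case False
  then show ?thesis by (simp add: cube_inner_def)
qed

lemma cube_inner_scale_right: "cube_inner g (\<lambda>\<xi>. a * h \<xi>) = a * cube_inner g h"
  by (simp add: cube_inner_def mult.left_commute)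

lemma cube_inner_sum_left:
  assumes "continuous_on ref_element g" "\<And>j. j \<in> J \<Longrightarrow> continuous_on ref_element (h j)"
  shows "cube_inner (\<lambda>\<xi>. \<Sum>j\<in>J. a j * h j \<xi>) g = (\<Sum>j\<in>J. a j * cube_inner (h j) g)"
  by (subst cube_inner_commute, subst cube_inner_sum_right)
     (auto intro!: continuous_intros assms sum.cong simp: cube_inner_scale_right cube_inner_commute[of g])

lemma cube_inner_diff_right:
  assumes "continuous_on ref_element g" "continuous_on ref_element h" "continuous_on ref_element h'"
  shows "cube_inner g (\<lambda>\<xi>. h \<xi> - h' \<xi>) = cube_inner g h - cube_inner g h'"
  unfolding cube_inner_def right_diff_distrib
  by (intro integral_diff continuous_on_integrable continuous_intros assms)

section \<open>Dual tensor-product bases and the projection\<close>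

text \<open>Expand each factor in the univariate basis and multiply out; \<open>s\<close> enumerates the resulting
  multi-indices.\<close>

lemma tensor_poly_expansion:
  fixes l :: "'n::finite \<Rightarrow> nat \<Rightarrow> real poly"
  assumes "\<And>k r. degree r \<le> p \<Longrightarrow> \<exists>c. r = (\<Sum>a\<le>p. smult (c a) (l k a))"
    and "bij_betw s I {\<alpha>. \<forall>k. \<alpha> k \<le> p}" "\<And>k. degree (r k) \<le> p"
  shows "\<exists>c. tensor_poly r = (\<lambda>\<xi>. \<Sum>i\<in>I. c i * tensor_poly (\<lambda>k. l k (s i k)) \<xi>)"
proof -
  have "\<forall>k. \<exists>c. r k = (\<Sum>a\<le>p. smult (c a) (l k a))"
    using assms(1)[OF assms(3)] by blast
  from choice[OF this] obtain c where c: "\<And>k. r k = (\<Sum>a\<le>p. smult (c k a) (l k a))"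
    by blast
  have PiE: "PiE UNIV (\<lambda>_. {..p}) = {\<alpha> :: 'n \<Rightarrow> nat. \<forall>k. \<alpha> k \<le> p}" by (auto simp: PiE_def)
  have "tensor_poly r \<xi> = (\<Sum>i\<in>I. (\<Prod>k\<in>UNIV. c k (s i k)) * tensor_poly (\<lambda>k. l k (s i k)) \<xi>)" for \<xi>
  proof -
    have "tensor_poly r \<xi> = (\<Prod>k\<in>UNIV. \<Sum>a\<le>p. c k a * poly (l k a) (\<xi> $ k))"
      by (simp add: tensor_poly_def c poly_sum)
    also have "\<dots> = (\<Sum>\<alpha>\<in>{\<alpha>. \<forall>k. \<alpha> k \<le> p}. \<Prod>k\<in>UNIV. c k (\<alpha> k) * poly (l k (\<alpha> k)) (\<xi> $ k))"
      by (subst prod_sum_PiE) (simp_all add: PiE)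
    also have "\<dots> = (\<Sum>i\<in>I. \<Prod>k\<in>UNIV. c k (s i k) * poly (l k (s i k)) (\<xi> $ k))"
      by (rule sum.reindex_bij_betw[OF assms(2), symmetric])
    finally show ?thesis by (simp add: tensor_poly_def prod.distrib)
  qed
  then show ?thesis by (intro exI[of _ "\<lambda>i. \<Prod>k\<in>UNIV. c k (s i k)"] ext)
qed

text \<open>Two biorthogonal families of tensor products, each spanning all tensor products of degree at most
  \<open>p\<close> per direction. Bundling both spans gives the two families symmetric roles.\<close>

definition tensor_dual_bases ::
  "nat \<Rightarrow> nat set \<Rightarrow> (nat \<Rightarrow> 'n::finite \<Rightarrow> real poly) \<Rightarrow> (nat \<Rightarrow> 'n \<Rightarrow> real poly) \<Rightarrow> bool" where
  "tensor_dual_bases p I q q' \<longleftrightarrow>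
     finite I \<and>
     (\<forall>i\<in>I. \<forall>k. degree (q i k) \<le> p \<and> degree (q' i k) \<le> p) \<and>
     (\<forall>i\<in>I. \<forall>j\<in>I. cube_inner (tensor_poly (q i)) (tensor_poly (q' j)) = (if i = j then 1 else 0)) \<and>
     (\<forall>r. (\<forall>k. degree (r k) \<le> p) \<longrightarrow>
        (\<exists>c. tensor_poly r = (\<lambda>\<xi>. \<Sum>i\<in>I. c i * tensor_poly (q i) \<xi>)) \<and>
        (\<exists>c. tensor_poly r = (\<lambda>\<xi>. \<Sum>i\<in>I. c i * tensor_poly (q' i) \<xi>)))"

lemma tensor_dual_bases_span:
  assumes "tensor_dual_bases p I q q'" "\<And>k. degree (r k) \<le> p"
  shows "\<exists>c. tensor_poly r = (\<lambda>\<xi>. \<Sum>i\<in>I. c i * tensor_poly (q i) \<xi>)"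
    and "\<exists>c. tensor_poly r = (\<lambda>\<xi>. \<Sum>i\<in>I. c i * tensor_poly (q' i) \<xi>)"
  using assms unfolding tensor_dual_bases_def by blast+

lemma tensor_basis_dual_bases:
  fixes \<phi> :: "nat \<Rightarrow> real ^ 'n \<Rightarrow> real"
  assumes "tensor_basis p \<phi>"
  obtains q q' :: "nat \<Rightarrow> 'n \<Rightarrow> real poly"
  where "tensor_dual_bases p {1..num_basis TYPE('n) p} q q'"
    "\<And>i. i \<in> {1..num_basis TYPE('n) p} \<Longrightarrow> \<phi> i = tensor_poly (q i)"
proof -
  let ?I = "{1..num_basis TYPE('n) p}"
  obtain l :: "'n \<Rightarrow> nat \<Rightarrow> real poly" and s where l: "\<And>k. poly_basis p (l k)"
    and s: "bij_betw s ?I {\<alpha>. \<forall>k. \<alpha> k \<le> p}"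
    and \<phi>: "\<forall>i\<in>?I. \<forall>\<xi>. \<phi> i \<xi> = (\<Prod>k\<in>UNIV. poly (l k (s i k)) (\<xi> $ k))"
    using assms unfolding tensor_basis_def by blast
  have "\<exists>l'. (\<forall>b\<le>p. degree (l' b) \<le> p) \<and>
      (\<forall>a\<le>p. \<forall>b\<le>p. poly_integral (l k a * l' b) = (if a = b then 1 else 0))" for k
    using poly_basis_dual[OF l[of k]] by metis
  then obtain l' where l': "\<And>k b. b \<le> p \<Longrightarrow> degree (l' k b) \<le> p"
      "\<And>k a b. a \<le> p \<Longrightarrow> b \<le> p \<Longrightarrow> poly_integral (l k a * l' k b) = (if a = b then 1 else 0)"
    by metis
  have s_le: "s i k \<le> p" if "i \<in> ?I" for i k using bij_betwE[OF s] that by blast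
  have s_inj: "s i = s j \<longleftrightarrow> i = j" if "i \<in> ?I" "j \<in> ?I" for i j
    using inj_on_eq_iff[OF bij_betw_imp_inj_on[OF s]] that by blast
  define q where "q = (\<lambda>i k. l k (s i k))"
  define q' where "q' = (\<lambda>i k. l' k (s i k))"
  have span: "\<exists>c. r = (\<Sum>a\<le>p. smult (c a) (l k a))" if "degree r \<le> p" for k r
    using l[of k] that unfolding poly_basis_def by blast
  have span': "\<exists>c. r = (\<Sum>a\<le>p. smult (c a) (l' k a))" if "degree r \<le> p" for k r
    by (intro exI, rule dual_basis_expansion[OF l[of k] _ _ that]) (simp_all add: l')
  have "tensor_dual_bases p ?I q q'"
    unfolding tensor_dual_bases_def
  proof (intro conjI ballI allI impI)
    fix i k assume "i \<in> ?I"
    then show "degree (q i k) \<le> p" "degree (q' i k) \<le> p"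
      using l[of k] l'(1) s_le unfolding q_def q'_def poly_basis_def by blast+
  next
    fix i j assume ij: "i \<in> ?I" "j \<in> ?I"
    have "cube_inner (tensor_poly (q i)) (tensor_poly (q' j)) = (\<Prod>k\<in>UNIV. if s i k = s j k then 1 else 0)"
      using ij s_le l'(2) by (simp add: cube_inner_tensor_poly q_def q'_def)
    also have "\<dots> = (if i = j then 1 else 0)"
      using s_inj[OF ij] by (auto simp: fun_eq_iff)
    finally show "cube_inner (tensor_poly (q i)) (tensor_poly (q' j)) = (if i = j then 1 else 0)" .
  next
    fix r :: "'n \<Rightarrow> real poly" assume r: "\<forall>k. degree (r k) \<le> p"
    show "\<exists>c. tensor_poly r = (\<lambda>\<xi>. \<Sum>i\<in>?I. c i * tensor_poly (q i) \<xi>)"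
      unfolding q_def using span r by (intro tensor_poly_expansion[OF _ s]) blast+
    show "\<exists>c. tensor_poly r = (\<lambda>\<xi>. \<Sum>i\<in>?I. c i * tensor_poly (q' i) \<xi>)"
      unfolding q'_def using span' r by (intro tensor_poly_expansion[OF _ s]) blast+
  qed simp
  moreover have "\<phi> i = tensor_poly (q i)" if "i \<in> ?I" for i
    using \<phi> that by (auto simp: q_def tensor_poly_def)
  ultimately show ?thesis by (rule that)
qed

lemma continuous_on_expansion:
  fixes \<phi> :: "nat \<Rightarrow> real ^ 'n \<Rightarrow> real"
  assumes "\<And>i. i \<in> {1..num_basis TYPE('n) p} \<Longrightarrow> \<phi> i = tensor_poly (q i)"
  shows "continuous_on S (expansion p \<phi> u)"
  unfolding expansion_def [abs_def] by (intro continuous_intros) (simp add: assms continuous_intros)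

text \<open>The two families have the same span, so the residual is orthogonal to one exactly if it is
  orthogonal to the other, and by biorthogonality its inner products with the dual
  functions vanish exactly if the coefficients have the stated values.\<close>

lemma L2_proj_eq_dual_inner:
  fixes \<phi> :: "nat \<Rightarrow> real ^ 'n \<Rightarrow> real"
  assumes dual: "tensor_dual_bases p {1..num_basis TYPE('n) p} q q'"
    and \<phi>: "\<And>i. i \<in> {1..num_basis TYPE('n) p} \<Longrightarrow> \<phi> i = tensor_poly (q i)"
    and g: "continuous_on ref_element g" and j: "j \<in> {1..num_basis TYPE('n) p}"
  shows "L2_proj p \<phi> g j = cube_inner (tensor_poly (q' j)) g"
proof -
  let ?I = "{1..num_basis TYPE('n) p}"
  let ?c = "\<lambda>j. if j \<in> ?I then cube_inner (tensor_poly (q' j)) g else 0"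
  have deg: "\<forall>k. degree (q i k) \<le> p" "\<forall>k. degree (q' i k) \<le> p" if "i \<in> ?I" for i
    using dual that unfolding tensor_dual_bases_def by auto
  have cont: "continuous_on ref_element (expansion p \<phi> c)" for c
    unfolding expansion_def [abs_def] by (intro continuous_intros) (simp add: \<phi> continuous_intros)
  have cont_res: "continuous_on ref_element (\<lambda>\<xi>. g \<xi> - expansion p \<phi> c \<xi>)" for c
    by (intro continuous_intros g cont)
  have coeff: "cube_inner (tensor_poly (q' i)) (\<lambda>\<xi>. g \<xi> - expansion p \<phi> c \<xi>)
      = cube_inner (tensor_poly (q' i)) g - c i" if i: "i \<in> ?I" for i c
  proof -
    have "cube_inner (tensor_poly (q' i)) (expansion p \<phi> c)
        = (\<Sum>j\<in>?I. cube_inner (tensor_poly (q' i)) (\<lambda>\<xi>. c j * tensor_poly (q j) \<xi>))"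
      unfolding expansion_def [abs_def]
      by (subst cube_inner_sum_right) (auto simp: \<phi> mult.commute intro!: continuous_intros)
    also have "\<dots> = (\<Sum>j\<in>?I. if j = i then c j else 0)"
      using dual i unfolding tensor_dual_bases_def
      by (intro sum.cong refl) (auto simp: cube_inner_scale_right cube_inner_commute[of "tensor_poly (q' i)"])
    also have "\<dots> = c i" using i by simp
    finally show ?thesis
      by (subst cube_inner_diff_right) (auto intro!: continuous_intros g cont)
  qed
  have orth_iff: "(\<forall>i\<in>?I. cube_inner (tensor_poly (q i)) h = 0) \<longleftrightarrow>
      (\<forall>i\<in>?I. cube_inner (tensor_poly (q' i)) h = 0)"
    if h: "continuous_on ref_element h" for h
  proof -
    have A: "cube_inner (tensor_poly r) h = 0"
      if "tensor_poly r = (\<lambda>\<xi>. \<Sum>i\<in>?I. c i * tensor_poly (b i) \<xi>)"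
        "\<forall>i\<in>?I. cube_inner (tensor_poly (b i)) h = 0" for r c and b :: "nat \<Rightarrow> 'n \<Rightarrow> real poly"
      unfolding that(1) using that(2) by (subst cube_inner_sum_left) (auto intro!: continuous_intros h)
    have span: "(\<exists>c. tensor_poly r = (\<lambda>\<xi>. \<Sum>i\<in>?I. c i * tensor_poly (q i) \<xi>)) \<and>
        (\<exists>c. tensor_poly r = (\<lambda>\<xi>. \<Sum>i\<in>?I. c i * tensor_poly (q' i) \<xi>))"
      if "\<forall>k. degree (r k) \<le> p" for r
      using dual that unfolding tensor_dual_bases_def by blast
    show ?thesis
    proof (intro iffI ballI)
      fix i assume *: "\<forall>i\<in>?I. cube_inner (tensor_poly (q i)) h = 0" and "i \<in> ?I"
      then obtain c where "tensor_poly (q' i) = (\<lambda>\<xi>. \<Sum>i\<in>?I. c i * tensor_poly (q i) \<xi>)"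
        using span deg(2) by blast
      then show "cube_inner (tensor_poly (q' i)) h = 0" using * by (rule A)
    next
      fix i assume *: "\<forall>i\<in>?I. cube_inner (tensor_poly (q' i)) h = 0" and "i \<in> ?I"
      then obtain c where "tensor_poly (q i) = (\<lambda>\<xi>. \<Sum>i\<in>?I. c i * tensor_poly (q' i) \<xi>)"
        using span deg(1) by blast
      then show "cube_inner (tensor_poly (q i)) h = 0" using * by (rule A)
    qed
  qed
  have orth: "(\<forall>i\<in>?I. integral ref_element (\<lambda>\<xi>. \<phi> i \<xi> * (g \<xi> - expansion p \<phi> c \<xi>)) = 0)
      \<longleftrightarrow> (\<forall>i\<in>?I. cube_inner (tensor_poly (q' i)) g = c i)" for c
    using orth_iff[OF cont_res[of c]] by (simp add: coeff) (simp add: \<phi> cube_inner_def)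
  have "L2_proj p \<phi> g = ?c"
    unfolding L2_proj_def orth by (rule the_equality) (auto simp: fun_eq_iff)
  then show ?thesis using j by simp
qed

lemma ref_gradient_tensor_poly:
  "ref_gradient (tensor_poly q) \<xi> $ k = tensor_poly (q(k := pderiv (q k))) \<xi>"
proof -
  have "((\<lambda>\<xi>. poly (q i) (\<xi> $ i)) has_derivative (\<lambda>h. poly (pderiv (q i)) (\<xi> $ i) * h $ i)) (at \<xi>)" for i
  proof -
    have "((\<lambda>x. poly (q i) x) has_derivative (\<lambda>h. poly (pderiv (q i)) (\<xi> $ i) * h)) (at (\<xi> $ i))"
      using poly_DERIV[of "q i" "\<xi> $ i"] by (simp add: has_field_derivative_def)
    from has_derivative_compose[OF bounded_linear.has_derivative[OF bounded_linear_vec_nth has_derivative_ident] this]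
    show ?thesis .
  qed
  then have "(tensor_poly q has_derivative
      (\<lambda>h. \<Sum>i\<in>UNIV. (poly (pderiv (q i)) (\<xi> $ i) * h $ i) * (\<Prod>j\<in>UNIV - {i}. poly (q j) (\<xi> $ j)))) (at \<xi>)"
    unfolding tensor_poly_def [abs_def] by (intro has_derivative_prod) auto
  then have "ref_gradient (tensor_poly q) \<xi> $ k = (\<Sum>i\<in>UNIV. (poly (pderiv (q i)) (\<xi> $ i) * axis k 1 $ i)
      * (\<Prod>j\<in>UNIV - {i}. poly (q j) (\<xi> $ j)))"
    unfolding ref_gradient_def by (simp add: frechet_derivative_at[symmetric])
  also have "\<dots> = (\<Sum>i\<in>UNIV. if i = k then poly (pderiv (q k)) (\<xi> $ k)
      * (\<Prod>j\<in>UNIV - {k}. poly (q j) (\<xi> $ j)) else 0)"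
    by (intro sum.cong) (auto simp: axis_def)
  also have "\<dots> = poly (pderiv (q k)) (\<xi> $ k) * (\<Prod>j\<in>UNIV - {k}. poly (q j) (\<xi> $ j))" by simp
  also have "\<dots> = tensor_poly (q(k := pderiv (q k))) \<xi>"
    unfolding tensor_poly_def by (subst (2) prod.remove[of _ k]) auto
  finally show ?thesis .
qed

text \<open>For \<open>p \<ge> 1\<close> the coordinate functions are tensor products of polynomials of degree at most \<open>p\<close>.\<close>

lemma expansion_linear_form:
  fixes \<phi> :: "nat \<Rightarrow> real ^ 'n \<Rightarrow> real" and a :: "real ^ 'n"
  assumes dual: "tensor_dual_bases p {1..num_basis TYPE('n) p} q q'"
    and \<phi>: "\<And>i. i \<in> {1..num_basis TYPE('n) p} \<Longrightarrow> \<phi> i = tensor_poly (q i)"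
    and p: "p \<ge> 1"
  shows "\<exists>u. \<forall>\<xi>. expansion p \<phi> u \<xi> = a \<bullet> \<xi>"
proof -
  let ?I = "{1..num_basis TYPE('n) p}"
  have "\<forall>k. \<exists>c. tensor_poly ((\<lambda>_. 1)(k := [:0, 1:])) = (\<lambda>\<xi>. \<Sum>i\<in>?I. c i * tensor_poly (q i) \<xi>)"
  proof
    fix k :: 'n
    show "\<exists>c. tensor_poly ((\<lambda>_. 1)(k := [:0, 1:])) = (\<lambda>\<xi>. \<Sum>i\<in>?I. c i * tensor_poly (q i) \<xi>)"
      using p by (intro tensor_dual_bases_span(1)[OF dual]) simp
  qed
  from choice[OF this] obtain c where
    c: "\<And>k. tensor_poly ((\<lambda>_. 1)(k := [:0, 1:])) = (\<lambda>\<xi>. \<Sum>i\<in>?I. c k i * tensor_poly (q i) \<xi>)"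
    by blast
  have coord: "(\<Sum>i\<in>?I. c k i * tensor_poly (q i) \<xi>) = \<xi> $ k" for k \<xi>
  proof -
    have "tensor_poly ((\<lambda>_. 1)(k := [:0, 1:])) \<xi> = \<xi> $ k"
      unfolding tensor_poly_def by (subst prod.remove[of _ k]) auto
    then show ?thesis by (simp only: c)
  qed
  have "expansion p \<phi> (\<lambda>i. \<Sum>k\<in>UNIV. a $ k * c k i) \<xi> = a \<bullet> \<xi>" for \<xi>
  proof -
    have "expansion p \<phi> (\<lambda>i. \<Sum>k\<in>UNIV. a $ k * c k i) \<xi>
        = (\<Sum>i\<in>?I. \<Sum>k\<in>UNIV. a $ k * (c k i * tensor_poly (q i) \<xi>))"
      unfolding expansion_def by (intro sum.cong refl) (simp add: \<phi> sum_distrib_left mult_ac)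
    also have "\<dots> = (\<Sum>k\<in>UNIV. a $ k * (\<Sum>i\<in>?I. c k i * tensor_poly (q i) \<xi>))"
      by (subst sum.swap) (simp add: sum_distrib_left)
    finally show ?thesis by (simp only: coord inner_vec_def inner_real_def)
  qed
  then show ?thesis by blast
qed

section \<open>Metric cofactors of an element mapping\<close>

lemma continuous_on_det:
  fixes A :: "'a::topological_space \<Rightarrow> real ^ 'n ^ 'n"
  assumes "\<And>i j. continuous_on S (\<lambda>x. A x $ i $ j)"
  shows "continuous_on S (\<lambda>x. det (A x))"
  unfolding det_def by (intro continuous_intros assms)

lemma matrix_inv_inverse:
  fixes A :: "real ^ 'n ^ 'n"
  assumes "invertible A"
  shows "A ** matrix_inv A = mat 1" "matrix_inv A ** A = mat 1"
  using someI_ex[OF assms[unfolded invertible_def]] unfolding matrix_inv_def by auto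

text \<open>Cramer's rule removes the matrix inverse, which makes continuity of the cofactors immediate.\<close>

lemma metric_cofactor_component:
  fixes \<Theta> :: "real ^ 'n \<Rightarrow> real ^ 'n"
  assumes "det (metric_jacobian \<Theta> \<xi>) \<noteq> 0"
  shows "metric_cofactor \<Theta> \<xi> $ n $ k
      = det (\<chi> i j. if j = k then axis n 1 $ i else metric_jacobian \<Theta> \<xi> $ i $ j)"
proof -
  let ?A = "metric_jacobian \<Theta> \<xi>"
  have "invertible ?A" using assms by (simp add: invertible_det_nz)
  then have "?A *v (matrix_inv ?A *v axis n 1) = axis n 1"
    by (simp add: matrix_vector_mul_assoc matrix_inv_inverse)
  then have "matrix_inv ?A *v axis n 1
      = (\<chi> k. det (\<chi> i j. if j = k then axis n 1 $ i else ?A $ i $ j) / det ?A)"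
    using cramer[OF assms] by blast
  then have "(matrix_inv ?A *v axis n 1) $ k
      = det (\<chi> i j. if j = k then axis n 1 $ i else ?A $ i $ j) / det ?A" by simp
  moreover have "(matrix_inv ?A *v axis n 1) $ k = matrix_inv ?A $ k $ n"
    by (simp add: matrix_vector_mult_basis column_def)
  ultimately show ?thesis
    using assms by (simp add: metric_cofactor_def transpose_def)
qed

lemma continuous_on_metric_jacobian_component:
  assumes "element_mapping \<Theta>"
  shows "continuous_on ref_element (\<lambda>\<xi>. metric_jacobian \<Theta> \<xi> $ i $ j)"
  using assms unfolding element_mapping_def by (intro continuous_intros) auto

lemma continuous_on_metric_cofactor_component:
  assumes "element_mapping \<Theta>"
  shows "continuous_on ref_element (\<lambda>\<xi>. metric_cofactor \<Theta> \<xi> $ n $ k)"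
proof -
  have "continuous_on ref_element
      (\<lambda>\<xi>. det (\<chi> i j. if j = k then axis n 1 $ i else metric_jacobian \<Theta> \<xi> $ i $ j))"
  proof (rule continuous_on_det)
    fix i j
    show "continuous_on ref_element
        (\<lambda>\<xi>. (\<chi> i j. if j = k then axis n 1 $ i else metric_jacobian \<Theta> \<xi> $ i $ j) $ i $ j)"
      using continuous_on_metric_jacobian_component[OF assms, of i j]
      by (cases "j = k") (simp_all add: continuous_on_const)
  qed
  then show ?thesis
    using assms by (subst continuous_on_cong[OF refl metric_cofactor_component]) (auto simp: element_mapping_def)
qed

text \<open>Taking determinants in \<open>C\<^sup>T J = (det J) I\<close> gives \<open>det C = (det J)\<^sup>d\<^sup>-\<^sup>1\<close>; the exponent is positive as
  \<open>d \<ge> 2\<close>, so \<open>\<bar>det J\<bar>\<close> is determined by the cofactors. In dimension one the cofactor is always \<open>1\<close>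
  and nothing follows.\<close>

lemma constant_metric_cofactor_imp_linear:
  fixes \<Theta> :: "real ^ 'n \<Rightarrow> real ^ 'n"
  assumes \<Theta>: "element_mapping \<Theta>" and dim: "CARD('n) \<ge> 2"
    and K: "\<And>\<xi>. \<xi> \<in> ref_element \<Longrightarrow> metric_cofactor \<Theta> \<xi> = K"
  shows "linear_mapping \<Theta>"
proof -
  let ?J = "metric_jacobian \<Theta>"
  have nz: "det (?J \<xi>) \<noteq> 0" if "\<xi> \<in> ref_element" for \<xi>
    using \<Theta> that by (simp add: element_mapping_def)
  have cube: "convex (ref_element :: (real ^ 'n) set)" by (simp add: ref_element_def)
  have cofactor: "transpose K ** ?J \<xi> = det (?J \<xi>) *\<^sub>R mat 1" if \<xi>: "\<xi> \<in> ref_element" for \<xi>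
  proof -
    have "transpose K = det (?J \<xi>) *\<^sub>R matrix_inv (?J \<xi>)"
      unfolding K[OF \<xi>, symmetric] metric_cofactor_def by (rule transpose_transpose)
    then have "transpose K ** ?J \<xi> = det (?J \<xi>) *\<^sub>R (matrix_inv (?J \<xi>) ** ?J \<xi>)"
      by (simp only: scalar_matrix_assoc)
    then show ?thesis using nz[OF \<xi>] by (simp add: matrix_inv_inverse(2) invertible_det_nz)
  qed
  have det_power: "det K = det (?J \<xi>) ^ (CARD('n) - 1)" if \<xi>: "\<xi> \<in> ref_element" for \<xi>
  proof -
    have "det K * det (?J \<xi>) = det (det (?J \<xi>) *\<^sub>R (mat 1 :: real ^ 'n ^ 'n))"
      using cofactor[OF \<xi>] by (metis det_mul det_transpose)
    also have "\<dots> = det (?J \<xi>) ^ CARD('n)"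
      by (subst det_diagonal) (simp_all add: mat_def)
    also have "\<dots> = det (?J \<xi>) ^ (CARD('n) - 1) * det (?J \<xi>)"
      by (simp flip: power_Suc2)
    finally show ?thesis using nz[OF \<xi>] by simp
  qed
  \<comment> \<open>A continuous function with values in \<open>{r, - r}\<close> on a connected set is constant.\<close>
  define r where "r = root (CARD('n) - 1) \<bar>det K\<bar>"
  have "\<bar>det (?J \<xi>)\<bar> = r" if "\<xi> \<in> ref_element" for \<xi>
    using dim by (simp add: r_def det_power[OF that] power_abs real_root_power_cancel)
  then have "(\<lambda>\<xi>. det (?J \<xi>)) ` ref_element \<subseteq> {r, - r}" by (force simp: abs_if split: if_splits)
  then have "finite ((\<lambda>\<xi>. det (?J \<xi>)) ` ref_element)" by (rule finite_subset) simp
  moreover have "continuous_on ref_element (\<lambda>\<xi>. det (?J \<xi>))"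
    by (intro continuous_on_det continuous_on_metric_jacobian_component \<Theta>)
  ultimately have "(\<lambda>\<xi>. det (?J \<xi>)) constant_on ref_element"
    using continuous_finite_range_constant convex_connected[OF cube] by blast
  then obtain d where d: "\<And>\<xi>. \<xi> \<in> ref_element \<Longrightarrow> det (?J \<xi>) = d"
    unfolding constant_on_def by blast
  define A where "A = matrix_inv (transpose K) ** (d *\<^sub>R mat 1)"
  have J: "?J \<xi> = A" if \<xi>: "\<xi> \<in> ref_element" for \<xi>
  proof -
    have "det (transpose K) \<noteq> 0" using det_power[OF \<xi>] nz[OF \<xi>] by simp
    then have "matrix_inv (transpose K) ** (transpose K ** ?J \<xi>) = ?J \<xi>"
      by (simp add: matrix_mul_assoc matrix_inv_inverse(2) invertible_det_nz)
    then show ?thesis by (simp add: A_def cofactor[OF \<xi>] d[OF \<xi>])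
  qed
  have "((\<lambda>\<xi>. \<Theta> \<xi> - A *v \<xi>) has_derivative (\<lambda>h. 0)) (at \<xi> within ref_element)"
    if \<xi>: "\<xi> \<in> ref_element" for \<xi>
  proof -
    have "\<Theta> differentiable (at \<xi> within ref_element)"
      using \<Theta> \<xi> by (simp add: element_mapping_def differentiable_on_def)
    then have "(\<Theta> has_derivative (\<lambda>h. A *v h)) (at \<xi> within ref_element)"
      using J[OF \<xi>] unfolding jacobian_works metric_jacobian_def by simp
    from has_derivative_diff[OF this bounded_linear_imp_has_derivative[OF matrix_vector_mul_bounded_linear[of A]]]
    show ?thesis by simp
  qed
  then have "\<exists>b. \<forall>\<xi>\<in>ref_element. \<Theta> \<xi> - A *v \<xi> = b"
    by (rule has_derivative_zero_constant[OF cube])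
  then obtain b where "\<forall>\<xi>\<in>ref_element. \<Theta> \<xi> - A *v \<xi> = b" by (elim exE)
  then have "\<forall>\<xi>\<in>ref_element. \<Theta> \<xi> = A *v \<xi> + b" by (simp add: diff_eq_eq add.commute)
  then show ?thesis unfolding linear_mapping_def by (intro exI)
qed

section \<open>The volume terms on exponential data\<close>

lemma vector_matrix_mult_component: "(v v* A) $ k = (\<Sum>i\<in>UNIV. v $ i * A $ i $ k)"
  for A :: "real ^ 'n ^ 'm"
  by (simp add: vector_matrix_mult_def mult.commute)

lemma sum_axis: "(\<Sum>i\<in>UNIV. (axis n 1 :: real ^ 'n) $ i * a i) = a n"
proof -
  have "(\<Sum>i\<in>UNIV. (axis n 1 :: real ^ 'n) $ i * a i) = (\<Sum>i\<in>UNIV. if i = n then a i else 0)"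
    by (intro sum.cong) (auto simp: axis_def)
  then show ?thesis by simp
qed

text \<open>A flux pointing along one axis selects one row of the cofactor matrix.\<close>

lemma conservative_volume_term_single_component:
  fixes \<phi> :: "nat \<Rightarrow> real ^ 'n \<Rightarrow> real"
  assumes dual: "tensor_dual_bases p {1..num_basis TYPE('n) p} q q'"
    and \<phi>: "\<And>i. i \<in> {1..num_basis TYPE('n) p} \<Longrightarrow> \<phi> i = tensor_poly (q i)"
    and \<Theta>: "element_mapping \<Theta>" and g: "continuous_on UNIV g"
    and i: "i \<in> {1..num_basis TYPE('n) p}"
  shows "conservative_volume_term p \<phi> \<Theta> (\<lambda>x. g x *\<^sub>R axis n 1) u i =
    (\<Sum>j = 1..num_basis TYPE('n) p. \<Sum>k\<in>UNIV.
       cube_inner (tensor_poly (q i)) (tensor_poly ((q j)(k := pderiv (q j k)))) *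
       cube_inner (tensor_poly (q' j)) (\<lambda>\<xi>. g (expansion p \<phi> u \<xi>) * metric_cofactor \<Theta> \<xi> $ n $ k))"
proof -
  let ?I = "{1..num_basis TYPE('n) p}"
  let ?a = "\<lambda>j k. cube_inner (tensor_poly (q' j)) (\<lambda>\<xi>. g (expansion p \<phi> u \<xi>) * metric_cofactor \<Theta> \<xi> $ n $ k)"
  let ?D = "\<lambda>j k. tensor_poly ((q j)(k := pderiv (q j k)))"
  have contu: "continuous_on S (expansion p \<phi> u)" for S
    using continuous_on_expansion \<phi> by blast
  have cont: "continuous_on ref_element (\<lambda>\<xi>. g (expansion p \<phi> u \<xi>) * metric_cofactor \<Theta> \<xi> $ n $ k)" for k
    by (intro continuous_on_mult continuous_on_compose2[OF g contu]
        continuous_on_metric_cofactor_component[OF \<Theta>]) auto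
  have comp: "((g x *\<^sub>R axis n 1) v* metric_cofactor \<Theta> \<xi>) $ k = g x * metric_cofactor \<Theta> \<xi> $ n $ k" for x \<xi> k
    by (simp add: vector_matrix_mult_component mult.assoc sum_distrib_left[symmetric] sum_axis)
  have proj: "L2_proj_vec p \<phi> (\<lambda>\<xi>. (g (expansion p \<phi> u \<xi>) *\<^sub>R axis n 1) v* metric_cofactor \<Theta> \<xi>) j
      = (\<chi> k. ?a j k)" if "j \<in> ?I" for j
    using L2_proj_eq_dual_inner[OF dual \<phi> cont that] by (simp add: L2_proj_vec_def comp)
  have inner: "ref_gradient (tensor_poly (q j)) \<xi> \<bullet> (\<chi> k. a k) = (\<Sum>k\<in>UNIV. a k * ?D j k \<xi>)" for j \<xi> a
    by (simp add: inner_vec_def ref_gradient_tensor_poly mult.commute)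
  have "conservative_volume_term p \<phi> \<Theta> (\<lambda>x. g x *\<^sub>R axis n 1) u i
      = cube_inner (tensor_poly (q i)) (\<lambda>\<xi>. \<Sum>j\<in>?I. \<Sum>k\<in>UNIV. ?a j k * ?D j k \<xi>)"
    unfolding conservative_volume_term_def cube_inner_def[of "tensor_poly (q i)"]
    using i by (simp only: proj \<phi> inner cong: sum.cong)
  also have "\<dots> = (\<Sum>j\<in>?I. \<Sum>k\<in>UNIV. cube_inner (tensor_poly (q i)) (?D j k) * ?a j k)"
    by (subst cube_inner_sum_right, (intro continuous_intros)+,
        subst cube_inner_sum_right, (intro continuous_intros)+,
        simp only: cube_inner_scale_right, simp only: mult.commute)
  finally show ?thesis .
qed

text \<open>The cofactors stay outside the projection, so that the flux enters only through its
  inner products with the dual basis.\<close>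

lemma nonconservative_volume_term_single_component:
  fixes \<phi> :: "nat \<Rightarrow> real ^ 'n \<Rightarrow> real"
  assumes dual: "tensor_dual_bases p {1..num_basis TYPE('n) p} q q'"
    and \<phi>: "\<And>i. i \<in> {1..num_basis TYPE('n) p} \<Longrightarrow> \<phi> i = tensor_poly (q i)"
    and \<Theta>: "element_mapping \<Theta>" and g: "continuous_on UNIV g"
    and i: "i \<in> {1..num_basis TYPE('n) p}"
  shows "nonconservative_volume_term p \<phi> \<Theta> (\<lambda>x. g x *\<^sub>R axis n 1) u i =
    (\<Sum>j = 1..num_basis TYPE('n) p. 
       cube_inner (tensor_poly (q i)) (\<lambda>\<xi>. \<Sum>k\<in>UNIV.
         tensor_poly ((q j)(k := pderiv (q j k))) \<xi> * metric_cofactor \<Theta> \<xi> $ n $ k) *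
       cube_inner (tensor_poly (q' j)) (\<lambda>\<xi>. g (expansion p \<phi> u \<xi>)))"
proof -
  let ?I = "{1..num_basis TYPE('n) p}"
  let ?b = "\<lambda>j. cube_inner (tensor_poly (q' j)) (\<lambda>\<xi>. g (expansion p \<phi> u \<xi>))"
  let ?D = "\<lambda>j \<xi>. \<Sum>k\<in>UNIV. tensor_poly ((q j)(k := pderiv (q j k))) \<xi> * metric_cofactor \<Theta> \<xi> $ n $ k"
  have contu: "continuous_on S (expansion p \<phi> u)" for S
    using continuous_on_expansion \<phi> by blast
  have cont: "continuous_on ref_element (\<lambda>\<xi>. g (expansion p \<phi> u \<xi>))"
    by (intro continuous_on_compose2[OF g contu]) auto
  have cont': "continuous_on ref_element (\<lambda>\<xi>. axis n 1 $ n' * g (expansion p \<phi> u \<xi>))" for n' :: 'n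
    by (intro continuous_intros cont)
  have proj: "L2_proj_vec p \<phi> (\<lambda>\<xi>. g (expansion p \<phi> u \<xi>) *\<^sub>R axis n 1) j = ?b j *\<^sub>R axis n 1"
    if "j \<in> ?I" for j
    using L2_proj_eq_dual_inner[OF dual \<phi> cont' that]
    by (simp add: L2_proj_vec_def vec_eq_iff mult.commute[of _ "axis n 1 $ _"] cube_inner_scale_right)
  have inner: "(ref_gradient (tensor_poly (q j)) \<xi> v* transpose (metric_cofactor \<Theta> \<xi>)) \<bullet> (b *\<^sub>R axis n 1)
      = b * ?D j \<xi>" for j \<xi> b
    by (simp add: inner_axis vector_matrix_mult_component transpose_def ref_gradient_tensor_poly)
  have contD: "continuous_on ref_element (?D j)" for j
    by (intro continuous_intros continuous_on_metric_cofactor_component \<Theta>)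
  have contbD: "continuous_on ref_element (\<lambda>\<xi>. ?b j * ?D j \<xi>)" for j
    by (intro continuous_on_mult continuous_on_const contD)
  have "nonconservative_volume_term p \<phi> \<Theta> (\<lambda>x. g x *\<^sub>R axis n 1) u i
      = cube_inner (tensor_poly (q i)) (\<lambda>\<xi>. \<Sum>j\<in>?I. ?b j * ?D j \<xi>)"
    unfolding nonconservative_volume_term_def cube_inner_def[of "tensor_poly (q i)"]
    using i by (simp only: proj \<phi> inner cong: sum.cong)
  also have "\<dots> = (\<Sum>j\<in>?I. cube_inner (tensor_poly (q i)) (?D j) * ?b j)"
    by (subst cube_inner_sum_right[OF continuous_on_tensor_poly], rule contbD,
        simp only: cube_inner_scale_right, simp only: mult.commute)
  finally show ?thesis .
qed

text \<open>The effect of the test function: a derivative in a direction \<open>k \<noteq> k0\<close> is killed by the Legendre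
  polynomial of degree \<open>p\<close> in that direction, and the one in direction \<open>k0\<close> is traded for a product of
  Legendre polynomials.\<close>

lemma cube_inner_test_pderiv:
  fixes r :: "'n::finite \<Rightarrow> real poly"
  assumes \<kappa>: "\<And>w. degree w \<le> p \<Longrightarrow>
        poly_integral (rodrigues (p - 1) * pderiv w) = \<kappa> * poly_integral (rodrigues p * w)"
    and r: "\<And>k. degree (r k) \<le> p"
  shows "cube_inner (tensor_poly ((\<lambda>_. rodrigues p)(k0 := rodrigues (p - 1))))
      (tensor_poly (r(k := pderiv (r k))))
    = (if k = k0 then \<kappa> * cube_inner (tensor_poly (\<lambda>_. rodrigues p)) (tensor_poly r) else 0)"
proof (cases "k = k0")
  case True
  show ?thesis
    unfolding cube_inner_tensor_poly True
    by (subst (1 2) prod.remove[of _ k0]) (simp_all add: \<kappa>[OF r] mult.assoc del: One_nat_def)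
next
  case False
  then have "poly_integral (((\<lambda>_. rodrigues p)(k0 := rodrigues (p - 1))) k * (r(k := pderiv (r k))) k) = 0"
    by (simp add: rodrigues_orthogonal_pderiv[OF r])
  then show ?thesis
    unfolding cube_inner_tensor_poly using False by (auto intro!: prod_zero)
qed

text \<open>Agreement for all basis functions extends by linearity to the test function with one factor of
  degree \<open>p - 1\<close>, in direction \<open>k0\<close>. Let \<open>E\<close> be the exponential of the discrete solution.
  The conservative term becomes \<open>\<kappa>\<close> times the inner product of \<open>E C $ n $ k0\<close> with the product
  of Legendre polynomials of degree \<open>p\<close>: the projection disappears because that product lies in the polynomial
  space. The non-conservative term is \<open>\<kappa>\<close> times the inner product of \<open>E\<close> with the dual expansion that has
  coefficients \<open>\<beta>\<close>.\<close>

lemma volume_terms_agree_imp: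
  fixes \<phi> :: "nat \<Rightarrow> real ^ 'n \<Rightarrow> real"
  assumes dual: "tensor_dual_bases p {1..num_basis TYPE('n) p} q q'"
    and \<phi>: "\<And>i. i \<in> {1..num_basis TYPE('n) p} \<Longrightarrow> \<phi> i = tensor_poly (q i)"
    and \<Theta>: "element_mapping \<Theta>" and p: "p \<ge> 1"
    and agree: "\<And>(f :: real \<Rightarrow> real ^ 'n) u i. f C1_differentiable_on UNIV \<Longrightarrow> i \<in> {1..num_basis TYPE('n) p} \<Longrightarrow>
       conservative_volume_term p \<phi> \<Theta> f u i = nonconservative_volume_term p \<phi> \<Theta> f u i"
  shows "\<exists>\<beta>. \<forall>u. cube_inner
      (\<lambda>\<xi>. tensor_poly (\<lambda>_. rodrigues p) \<xi> * metric_cofactor \<Theta> \<xi> $ n $ k0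
           - (\<Sum>j = 1..num_basis TYPE('n) p. \<beta> j * tensor_poly (q' j) \<xi>))
      (\<lambda>\<xi>. exp (expansion p \<phi> u \<xi>)) = 0"
proof -
  let ?I = "{1..num_basis TYPE('n) p}"
  let ?\<Psi> = "tensor_poly (\<lambda>_ :: 'n. rodrigues p)"
  let ?C = "\<lambda>k \<xi>. metric_cofactor \<Theta> \<xi> $ n $ k"
  let ?D = "\<lambda>j k. tensor_poly ((q j)(k := pderiv (q j k)))"
  let ?v = "(\<lambda>_ :: 'n. rodrigues p)(k0 := rodrigues (p - 1))"
  have deg: "degree (q i k) \<le> p" if "i \<in> ?I" for i k
    using dual that unfolding tensor_dual_bases_def by auto
  have delta: "cube_inner (tensor_poly (q i)) (tensor_poly (q' j)) = (if i = j then 1 else 0)"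
    if "i \<in> ?I" "j \<in> ?I" for i j
    using dual that unfolding tensor_dual_bases_def by auto
  obtain \<kappa> where \<kappa>: "\<kappa> \<noteq> 0" "\<And>w. degree w \<le> p \<Longrightarrow>
        poly_integral (rodrigues (p - 1) * pderiv w) = \<kappa> * poly_integral (rodrigues p * w)"
    using rodrigues_derivative_adjoint[OF p] by blast
  obtain t where t: "tensor_poly ?v = (\<lambda>\<xi>. \<Sum>i\<in>?I. t i * tensor_poly (q i) \<xi>)"
  proof -
    have "degree (?v k) \<le> p" for k by (simp add: degree_rodrigues)
    with tensor_dual_bases_span(1)[OF dual, of ?v] show ?thesis using that by blast
  qed
  \<comment> \<open>In the dual basis, so that the coefficients match those of the projection.\<close>
  obtain s where s: "?\<Psi> = (\<lambda>\<xi>. \<Sum>j\<in>?I. s j * tensor_poly (q' j) \<xi>)"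
    using tensor_dual_bases_span(2)[OF dual, of "\<lambda>_. rodrigues p"] eq_imp_le[OF degree_rodrigues[of p]] by blast
  have s_eq: "cube_inner ?\<Psi> (tensor_poly (q j)) = s j" if j: "j \<in> ?I" for j
  proof -
    have "cube_inner ?\<Psi> (tensor_poly (q j)) = (\<Sum>i\<in>?I. s i * cube_inner (tensor_poly (q' i)) (tensor_poly (q j)))"
      by (subst s, rule cube_inner_sum_left) (intro continuous_intros)+
    also have "\<dots> = (\<Sum>i\<in>?I. if i = j then s i else 0)"
      using j by (intro sum.cong) (auto simp: cube_inner_commute[of "tensor_poly (q' _)"] delta)
    finally show ?thesis using j by simp
  qed
  define \<beta> where "\<beta> = (\<lambda>j. cube_inner (tensor_poly ?v) (\<lambda>\<xi>. \<Sum>k\<in>UNIV. ?D j k \<xi> * ?C k \<xi>) / \<kappa>)"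
  have \<beta>: "\<kappa> * \<beta> j = cube_inner (tensor_poly ?v) (\<lambda>\<xi>. \<Sum>k\<in>UNIV. ?D j k \<xi> * ?C k \<xi>)" for j
    using \<kappa>(1) by (simp add: \<beta>_def)
  have test: "(\<Sum>i\<in>?I. t i * cube_inner (tensor_poly (q i)) h) = cube_inner (tensor_poly ?v) h"
    if "continuous_on ref_element h" for h
    by (subst t, rule cube_inner_sum_left[symmetric]) (intro continuous_intros that)+
  have testD: "cube_inner (tensor_poly ?v) (?D j k) = (if k = k0 then \<kappa> * s j else 0)" if "j \<in> ?I" for j k
    using cube_inner_test_pderiv[where r = "q j" and k = k and k0 = k0, OF \<kappa>(2) deg[OF that]] s_eq[OF that] by simp
  show ?thesis
  proof (intro exI allI)
    fix u
    let ?E = "\<lambda>\<xi>. exp (expansion p \<phi> u \<xi>)"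
    let ?f = "\<lambda>x. exp x *\<^sub>R (axis n 1 :: real ^ 'n)"
    have "continuous_on ref_element (expansion p \<phi> u)"
      using continuous_on_expansion \<phi> by blast
    then have contE: "continuous_on ref_element ?E" by (intro continuous_intros)
    have contC: "continuous_on ref_element (?C k)" for k
      by (rule continuous_on_metric_cofactor_component[OF \<Theta>])
    have contD: "continuous_on ref_element (\<lambda>\<xi>. \<Sum>k\<in>UNIV. ?D j k \<xi> * ?C k \<xi>)" for j
      by (intro continuous_intros contC)
    have f: "?f C1_differentiable_on UNIV"
      unfolding C1_differentiable_on_def
      by (intro exI[of _ ?f] conjI ballI continuous_intros)
         (auto intro!: derivative_eq_intros simp: has_real_derivative_iff_has_vector_derivative[symmetric])
    have cexp: "continuous_on UNIV (exp :: real \<Rightarrow> real)" by (intro continuous_intros)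
    have "(\<Sum>i\<in>?I. t i * conservative_volume_term p \<phi> \<Theta> ?f u i)
        = (\<Sum>i\<in>?I. \<Sum>j\<in>?I. \<Sum>k\<in>UNIV. t i * cube_inner (tensor_poly (q i)) (?D j k) *
             cube_inner (tensor_poly (q' j)) (\<lambda>\<xi>. ?E \<xi> * ?C k \<xi>))"
      by (intro sum.cong refl)
         (simp only: conservative_volume_term_single_component[OF dual \<phi> \<Theta> cexp] sum_distrib_left mult.assoc)
    also have "\<dots> = (\<Sum>j\<in>?I. \<Sum>k\<in>UNIV. (\<Sum>i\<in>?I. t i * cube_inner (tensor_poly (q i)) (?D j k)) *
             cube_inner (tensor_poly (q' j)) (\<lambda>\<xi>. ?E \<xi> * ?C k \<xi>))"
      by (subst sum.swap, intro sum.cong refl, subst sum.swap) (simp add: sum_distrib_right)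
    also have "\<dots> = (\<Sum>j\<in>?I. \<Sum>k\<in>UNIV. cube_inner (tensor_poly ?v) (?D j k) *
             cube_inner (tensor_poly (q' j)) (\<lambda>\<xi>. ?E \<xi> * ?C k \<xi>))"
      by (simp only: test[OF continuous_on_tensor_poly])
    also have "\<dots> = (\<Sum>j\<in>?I. \<Sum>k\<in>UNIV. if k = k0 then \<kappa> * s j *
             cube_inner (tensor_poly (q' j)) (\<lambda>\<xi>. ?E \<xi> * ?C k \<xi>) else 0)"
      by (intro sum.cong refl) (simp add: testD del: One_nat_def)
    also have "\<dots> = \<kappa> * (\<Sum>j\<in>?I. s j * cube_inner (tensor_poly (q' j)) (\<lambda>\<xi>. ?E \<xi> * ?C k0 \<xi>))"
      by (simp add: sum_distrib_left mult.assoc)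
    also have "\<dots> = \<kappa> * cube_inner ?\<Psi> (\<lambda>\<xi>. ?E \<xi> * ?C k0 \<xi>)"
      by (subst s, subst cube_inner_sum_left) (auto intro!: continuous_intros contE contC)
    finally have cons: "(\<Sum>i\<in>?I. t i * conservative_volume_term p \<phi> \<Theta> ?f u i)
        = \<kappa> * cube_inner ?\<Psi> (\<lambda>\<xi>. ?E \<xi> * ?C k0 \<xi>)" .
    have "(\<Sum>i\<in>?I. t i * nonconservative_volume_term p \<phi> \<Theta> ?f u i)
        = (\<Sum>i\<in>?I. \<Sum>j\<in>?I. t i * cube_inner (tensor_poly (q i)) (\<lambda>\<xi>. \<Sum>k\<in>UNIV. ?D j k \<xi> * ?C k \<xi>) *
             cube_inner (tensor_poly (q' j)) ?E)"
      by (intro sum.cong refl)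
         (simp only: nonconservative_volume_term_single_component[OF dual \<phi> \<Theta> cexp] sum_distrib_left mult.assoc)
    also have "\<dots> = (\<Sum>j\<in>?I. (\<Sum>i\<in>?I. t i * cube_inner (tensor_poly (q i)) (\<lambda>\<xi>. \<Sum>k\<in>UNIV. ?D j k \<xi> * ?C k \<xi>)) *
             cube_inner (tensor_poly (q' j)) ?E)"
      by (subst sum.swap) (simp only: sum_distrib_right)
    also have "\<dots> = (\<Sum>j\<in>?I. \<kappa> * \<beta> j * cube_inner (tensor_poly (q' j)) ?E)"
      by (simp only: test[OF contD] \<beta>)
    also have "\<dots> = \<kappa> * cube_inner (\<lambda>\<xi>. \<Sum>j\<in>?I. \<beta> j * tensor_poly (q' j) \<xi>) ?E"
      by (subst cube_inner_sum_left) (auto intro!: continuous_intros contE simp: sum_distrib_left mult.assoc)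
    finally have noncons: "(\<Sum>i\<in>?I. t i * nonconservative_volume_term p \<phi> \<Theta> ?f u i)
        = \<kappa> * cube_inner (\<lambda>\<xi>. \<Sum>j\<in>?I. \<beta> j * tensor_poly (q' j) \<xi>) ?E" .
    have "\<kappa> * cube_inner ?\<Psi> (\<lambda>\<xi>. ?E \<xi> * ?C k0 \<xi>)
        = \<kappa> * cube_inner (\<lambda>\<xi>. \<Sum>j\<in>?I. \<beta> j * tensor_poly (q' j) \<xi>) ?E"
      unfolding cons[symmetric] noncons[symmetric]
      by (intro sum.cong refl) (simp only: agree[OF f])
    then have "cube_inner ?\<Psi> (\<lambda>\<xi>. ?E \<xi> * ?C k0 \<xi>)
        = cube_inner (\<lambda>\<xi>. \<Sum>j\<in>?I. \<beta> j * tensor_poly (q' j) \<xi>) ?E"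
      using \<kappa>(1) by simp
    moreover have "cube_inner ?\<Psi> (\<lambda>\<xi>. ?E \<xi> * ?C k0 \<xi>) = cube_inner ?E (\<lambda>\<xi>. ?\<Psi> \<xi> * ?C k0 \<xi>)"
      by (simp add: cube_inner_def mult_ac)
    ultimately show "cube_inner (\<lambda>\<xi>. ?\<Psi> \<xi> * ?C k0 \<xi> - (\<Sum>j\<in>?I. \<beta> j * tensor_poly (q' j) \<xi>)) ?E = 0"
      by (subst cube_inner_commute, subst cube_inner_diff_right)
         (auto intro!: continuous_intros contE contC simp: cube_inner_commute[of _ ?E])
  qed
qed

section \<open>Completeness of exponentials on the cube\<close>

text \<open>The algebra generated by the functions \<open>exp (a \<bullet> \<xi>)\<close>; it is closed under products because
  exponents add.\<close>

inductive exponential_sum :: "(real ^ 'n \<Rightarrow> real) \<Rightarrow> bool" where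
  exponential: "exponential_sum (\<lambda>\<xi>. b * exp (a \<bullet> \<xi>))"
| add: "exponential_sum g \<Longrightarrow> exponential_sum h \<Longrightarrow> exponential_sum (\<lambda>\<xi>. g \<xi> + h \<xi>)"

lemma exponential_sum_mult:
  assumes "exponential_sum g" "exponential_sum h"
  shows "exponential_sum (\<lambda>\<xi>. g \<xi> * h \<xi>)"
  using assms(1)
proof induction
  case (exponential b a)
  from assms(2) show ?case
  proof induction
    case (exponential b' a')
    have "exponential_sum (\<lambda>\<xi>. (b * b') * exp ((a + a') \<bullet> \<xi>))" by (rule exponential_sum.exponential)
    then show ?case by (simp add: inner_add_left exp_add mult_ac)
  next
    case (add g h)
    from exponential_sum.add[OF add.IH] show ?case by (simp add: distrib_left)
  qed
next
  case (add g1 g2)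
  from exponential_sum.add[OF add.IH] show ?case by (simp add: distrib_right)
qed

lemma exponential_sum_continuous: "exponential_sum g \<Longrightarrow> continuous_on S g"
  by (induction rule: exponential_sum.induct) (intro continuous_intros; assumption?)+

text \<open>The exponentials separate points, so \<open>\<psi>\<close> is a uniform limit of exponential sums. Orthogonality to
  these makes the squared norm of \<open>\<psi>\<close> vanish.\<close>

lemma orthogonal_to_exponentials_imp_zero:
  fixes \<psi> :: "real ^ 'n \<Rightarrow> real"
  assumes \<psi>: "continuous_on ref_element \<psi>"
    and orth: "\<And>a. cube_inner \<psi> (\<lambda>\<xi>. exp (a \<bullet> \<xi>)) = 0"
    and \<xi>: "\<xi> \<in> ref_element"
  shows "\<psi> \<xi> = 0"
proof -
  have orth_sum: "cube_inner \<psi> g = 0" if "exponential_sum g" for g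
    using that
  proof induction
    case (exponential b a)
    show ?case by (simp add: cube_inner_scale_right orth)
  next
    case (add g h)
    have "cube_inner \<psi> (\<lambda>\<xi>. g \<xi> + h \<xi>) = cube_inner \<psi> g + cube_inner \<psi> h"
      unfolding cube_inner_def distrib_left
      by (intro integral_add continuous_on_integrable continuous_on_mult \<psi> exponential_sum_continuous add.hyps)
    then show ?case using add.IH by simp
  qed
  have cint: "(\<lambda>\<xi>. \<psi> \<xi> * \<psi> \<xi>) integrable_on ref_element"
    "(\<lambda>\<xi>. \<bar>\<psi> \<xi>\<bar>) integrable_on ref_element"
    by (intro continuous_on_integrable continuous_intros \<psi>)+
  define K where "K = integral ref_element (\<lambda>\<xi>. \<bar>\<psi> \<xi>\<bar>)"
  have K: "K \<ge> 0" unfolding K_def by (intro integral_nonneg cint) auto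
  have bound: "cube_inner \<psi> \<psi> \<le> e * K" if "e > 0" for e
  proof -
    have "\<exists>g. exponential_sum g \<and> (\<forall>\<xi>\<in>ref_element. \<bar>\<psi> \<xi> - g \<xi>\<bar> < e)"
    proof (rule Stone_Weierstrass_HOL[OF compact_ref_element _ _ _ _ _ \<psi> that])
      show "exponential_sum (\<lambda>\<xi> :: real ^ 'n. b)" for b
        using exponential_sum.exponential[of b 0] by simp
      fix x y :: "real ^ 'n" assume "x \<in> ref_element \<and> y \<in> ref_element \<and> x \<noteq> y"
      then obtain k where "x $ k \<noteq> y $ k" by (auto simp: vec_eq_iff)
      then show "\<exists>g. exponential_sum g \<and> g x \<noteq> g y"
        using exponential_sum.exponential[of 1 "axis k 1"]
        by (intro exI[of _ "\<lambda>\<xi>. 1 * exp (axis k 1 \<bullet> \<xi>)"]) (simp add: inner_axis')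
    qed (auto intro: exponential_sum_continuous exponential_sum.add exponential_sum_mult)
    then obtain g where g: "exponential_sum g" "\<And>\<xi>. \<xi> \<in> ref_element \<Longrightarrow> \<bar>\<psi> \<xi> - g \<xi>\<bar> < e" by blast
    have contg: "continuous_on ref_element g" using g(1) by (rule exponential_sum_continuous)
    have "cube_inner \<psi> \<psi> = cube_inner \<psi> (\<lambda>\<xi>. \<psi> \<xi> - g \<xi>)"
      using cube_inner_diff_right[OF \<psi> \<psi> contg] orth_sum[OF g(1)] by simp
    also have "\<dots> \<le> integral ref_element (\<lambda>\<xi>. e * \<bar>\<psi> \<xi>\<bar>)"
      unfolding cube_inner_def
    proof (rule integral_le)
      show "(\<lambda>\<xi>. \<psi> \<xi> * (\<psi> \<xi> - g \<xi>)) integrable_on ref_element"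
        "(\<lambda>\<xi>. e * \<bar>\<psi> \<xi>\<bar>) integrable_on ref_element"
        by (intro continuous_on_integrable continuous_intros \<psi> contg)+
      fix \<xi> :: "real ^ 'n" assume "\<xi> \<in> ref_element"
      have "\<psi> \<xi> * (\<psi> \<xi> - g \<xi>) \<le> \<bar>\<psi> \<xi>\<bar> * \<bar>\<psi> \<xi> - g \<xi>\<bar>"
        by (metis abs_ge_self abs_mult)
      also have "\<dots> \<le> \<bar>\<psi> \<xi>\<bar> * e"
        using g(2)[OF \<open>\<xi> \<in> ref_element\<close>] by (intro mult_left_mono) auto
      finally show "\<psi> \<xi> * (\<psi> \<xi> - g \<xi>) \<le> e * \<bar>\<psi> \<xi>\<bar>" by (simp add: mult.commute)
    qed
    also have "\<dots> = e * K" by (simp add: K_def)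
    finally show ?thesis .
  qed
  have "cube_inner \<psi> \<psi> \<le> 0"
  proof (rule field_le_epsilon)
    fix e :: real assume e: "e > 0"
    \<comment> \<open>Dividing by \<open>K + 1\<close> avoids a case distinction on \<open>K = 0\<close>.\<close>
    have "cube_inner \<psi> \<psi> \<le> e / (K + 1) * K" using e K by (intro bound) (simp add: divide_pos_pos)
    also have "\<dots> = e * (K / (K + 1))" by simp
    also have "\<dots> \<le> e * 1" using e K by (intro mult_left_mono) auto
    finally show "cube_inner \<psi> \<psi> \<le> 0 + e" by simp
  qed
  moreover have "cube_inner \<psi> \<psi> \<ge> 0"
    unfolding cube_inner_def by (intro integral_nonneg cint) auto
  ultimately have "integral ref_element (\<lambda>\<xi>. \<psi> \<xi> * \<psi> \<xi>) = 0" by (simp add: cube_inner_def)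
  moreover have "(0 :: real ^ 'n) \<in> box (\<chi> k. -1) (\<chi> k. 1)" by (simp add: mem_box_cart)
  then have "box (\<chi> k. -1) (\<chi> k. 1) \<noteq> ({} :: (real ^ 'n) set)" by blast
  ultimately have "\<forall>\<xi>\<in>ref_element. \<psi> \<xi> * \<psi> \<xi> = 0"
    using integral_cbox_eq_0_iff[of "\<chi> k. -1" "\<chi> k. 1" "\<lambda>\<xi>. \<psi> \<xi> * \<psi> \<xi>"] \<psi>
    unfolding ref_element_def by (simp add: continuous_on_mult)
  then show ?thesis using \<xi> by simp
qed

section \<open>Continuous quotients by a product of Legendre polynomials\<close>

text \<open>On a line parallel to the \<open>j\<close>th axis, all factors but the \<open>j\<close>th are constant.\<close>

lemma tensor_poly_slice:
  fixes q :: "nat \<Rightarrow> 'n::finite \<Rightarrow> real poly"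
  assumes "\<And>i. i \<in> I \<Longrightarrow> degree (q i j) \<le> p"
  obtains h where "degree h \<le> p"
    "\<And>x. (\<Sum>i\<in>I. \<beta> i * tensor_poly (q i) (\<chi> k. if k = j then x else \<xi> $ k)) = poly h x"
proof
  define b where "b = (\<lambda>i. \<beta> i * (\<Prod>k\<in>UNIV - {j}. poly (q i k) (\<xi> $ k)))"
  show "degree (\<Sum>i\<in>I. smult (b i) (q i j)) \<le> p"
    using assms by (rule degree_sum_smult_le)
  show "(\<Sum>i\<in>I. \<beta> i * tensor_poly (q i) (\<chi> k. if k = j then x else \<xi> $ k))
      = poly (\<Sum>i\<in>I. smult (b i) (q i j)) x" for x
    unfolding poly_sum
  proof (intro sum.cong refl)
    fix i
    have "(\<Prod>k\<in>UNIV - {j}. poly (q i k) (if k = j then x else \<xi> $ k))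
        = (\<Prod>k\<in>UNIV - {j}. poly (q i k) (\<xi> $ k))" by (intro prod.cong) auto
    then show "\<beta> i * tensor_poly (q i) (\<chi> k. if k = j then x else \<xi> $ k) = poly (smult (b i) (q i j)) x"
      unfolding tensor_poly_def b_def by (subst prod.remove[of _ j]) simp_all
  qed
qed

text \<open>On the line through \<open>\<xi>\<close> and \<open>\<eta>\<close> the numerator is a polynomial of degree at most \<open>p\<close> that vanishes at
  all roots of the Legendre polynomial, hence a multiple of it.\<close>

lemma tensor_poly_quotient_constant_on_line:
  fixes q :: "nat \<Rightarrow> 'n::finite \<Rightarrow> real poly"
  assumes deg: "\<And>i k. i \<in> I \<Longrightarrow> degree (q i k) \<le> p"
    and eq: "\<And>\<xi>. \<xi> \<in> ref_element \<Longrightarrow>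
       tensor_poly (\<lambda>_. rodrigues p) \<xi> * c \<xi> = (\<Sum>i\<in>I. \<beta> i * tensor_poly (q i) \<xi>)"
    and \<xi>: "\<xi> \<in> ref_element" "tensor_poly (\<lambda>_. rodrigues p) \<xi> \<noteq> 0"
    and \<eta>: "\<eta> \<in> ref_element" "tensor_poly (\<lambda>_. rodrigues p) \<eta> \<noteq> 0"
    and same: "\<And>k. k \<noteq> j \<Longrightarrow> \<xi> $ k = \<eta> $ k"
  shows "c \<xi> = c \<eta>"
proof -
  let ?L = "rodrigues p"
  let ?line = "\<lambda>x. (\<chi> k. if k = j then x else \<xi> $ k) :: real ^ 'n"
  define A where "A = (\<Prod>k\<in>UNIV - {j}. poly ?L (\<xi> $ k))"
  have slice: "tensor_poly (\<lambda>_. ?L) (?line x) = poly ?L x * A" for x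
    unfolding tensor_poly_def A_def by (subst prod.remove[of _ j]) (auto intro!: prod.cong)
  have line: "\<xi> = ?line (\<xi> $ j)" "\<eta> = ?line (\<eta> $ j)"
    using same by (auto simp: vec_eq_iff)
  have line_mem: "?line x \<in> ref_element" if "-1 \<le> x" "x \<le> 1" for x
    using \<xi>(1) that by (auto simp: mem_ref_element)
  obtain h where h: "degree h \<le> p" "\<And>x. (\<Sum>i\<in>I. \<beta> i * tensor_poly (q i) (?line x)) = poly h x"
    using tensor_poly_slice[of I q j p \<beta> \<xi>] deg by blast
  have h_eq: "poly ?L x * A * c (?line x) = poly h x" if "-1 \<le> x" "x \<le> 1" for x
    using eq[OF line_mem[OF that]] by (simp only: h(2) slice)
  have "\<exists>a. h = smult a ?L"
    using h_eq by (intro multiple_of_rodrigues h(1)) fastforce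
  then obtain a where a: "h = smult a ?L" by blast
  have c: "c (?line x) = a / A" if "-1 \<le> x" "x \<le> 1" "tensor_poly (\<lambda>_. ?L) (?line x) \<noteq> 0" for x
    using h_eq[OF that(1,2)] that(3) unfolding slice a by (simp add: field_simps)
  have range: "-1 \<le> \<xi> $ j" "\<xi> $ j \<le> 1" "-1 \<le> \<eta> $ j" "\<eta> $ j \<le> 1"
    using \<xi>(1) \<eta>(1) by (auto simp: mem_ref_element)
  have "c \<xi> = a / A" using c[OF range(1,2)] \<xi>(2) line(1) by simp
  moreover have "c \<eta> = a / A" using c[OF range(3,4)] \<eta>(2) line(2) by simp
  ultimately show ?thesis by simp
qed

text \<open>In each coordinate only finitely many values are roots of \<open>L\<close>.\<close>

lemma tensor_poly_nonzero_approx: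
  fixes \<xi> :: "real ^ 'n"
  assumes "L \<noteq> 0" "\<xi> \<in> ref_element" "e > 0"
  obtains \<eta> where "\<eta> \<in> ref_element" "tensor_poly (\<lambda>_. L) \<eta> \<noteq> 0" "dist \<eta> \<xi> < e"
proof -
  \<comment> \<open>Leaves room for the sum of all coordinate errors to stay strictly below \<open>e\<close>.\<close>
  define d where "d = e / (2 * real CARD('n))"
  have d: "d > 0" using assms(3) by (simp add: d_def)
  have "\<forall>k. \<exists>y. -1 \<le> y \<and> y \<le> 1 \<and> \<bar>y - \<xi> $ k\<bar> \<le> d \<and> poly L y \<noteq> 0"
  proof
    fix k
    have x: "-1 \<le> \<xi> $ k" "\<xi> $ k \<le> 1" using assms(2) by (auto simp: mem_ref_element)
    have "max (-1) (\<xi> $ k - d) < min 1 (\<xi> $ k + d)" using x d by auto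
    then have "infinite {max (-1) (\<xi> $ k - d)..min 1 (\<xi> $ k + d)}" by (rule infinite_Icc)
    then have "\<not> {max (-1) (\<xi> $ k - d)..min 1 (\<xi> $ k + d)} \<subseteq> {y. poly L y = 0}"
      using poly_roots_finite[OF assms(1)] finite_subset by blast
    then obtain y where "y \<in> {max (-1) (\<xi> $ k - d)..min 1 (\<xi> $ k + d)}" "poly L y \<noteq> 0" by blast
    then show "\<exists>y. -1 \<le> y \<and> y \<le> 1 \<and> \<bar>y - \<xi> $ k\<bar> \<le> d \<and> poly L y \<noteq> 0"
      by (intro exI[of _ y]) auto
  qed
  from choice[OF this] obtain y where
    y: "\<And>k. -1 \<le> y k \<and> y k \<le> 1 \<and> \<bar>y k - \<xi> $ k\<bar> \<le> d \<and> poly L (y k) \<noteq> 0" by blast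
  let ?\<eta> = "\<chi> k. y k"
  have "norm (?\<eta> - \<xi>) \<le> (\<Sum>k\<in>UNIV. \<bar>(?\<eta> - \<xi>) $ k\<bar>)" by (rule norm_le_l1_cart)
  also have "\<dots> \<le> (\<Sum>k\<in>(UNIV :: 'n set). d)" using y by (intro sum_mono) simp
  also have "\<dots> = e / 2" by (simp add: d_def)
  finally have "dist ?\<eta> \<xi> < e" using assms(3) by (simp add: dist_norm)
  moreover have "?\<eta> \<in> ref_element" using y by (simp add: mem_ref_element)
  moreover have "tensor_poly (\<lambda>_. L) ?\<eta> \<noteq> 0" using y by (simp add: tensor_poly_def)
  ultimately show ?thesis by (rule that[rotated 2])
qed

text \<open>Two points with no coordinate at a root are joined by changing one coordinate at a time, which
  keeps all coordinates away from the roots. Such points are dense, and \<open>c\<close> is continuous.\<close>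

lemma tensor_poly_quotient_constant:
  fixes q :: "nat \<Rightarrow> 'n::finite \<Rightarrow> real poly"
  assumes deg: "\<And>i k. i \<in> I \<Longrightarrow> degree (q i k) \<le> p"
    and eq: "\<And>\<xi>. \<xi> \<in> ref_element \<Longrightarrow>
       tensor_poly (\<lambda>_. rodrigues p) \<xi> * c \<xi> = (\<Sum>i\<in>I. \<beta> i * tensor_poly (q i) \<xi>)"
    and c: "continuous_on ref_element c"
  shows "\<exists>a. \<forall>\<xi>\<in>ref_element. c \<xi> = a"
proof -
  let ?\<Psi> = "tensor_poly (\<lambda>_ :: 'n. rodrigues p)"
  have nonroot: "?\<Psi> \<xi> \<noteq> 0 \<longleftrightarrow> (\<forall>k. poly (rodrigues p) (\<xi> $ k) \<noteq> 0)" for \<xi>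
    by (auto simp: tensor_poly_def)
  have generic: "c \<xi> = c \<eta>"
    if \<xi>: "\<xi> \<in> ref_element" "?\<Psi> \<xi> \<noteq> 0" and \<eta>: "\<eta> \<in> ref_element" "?\<Psi> \<eta> \<noteq> 0" for \<xi> \<eta>
  proof -
    let ?mix = "\<lambda>S. (\<chi> k. if k \<in> S then \<xi> $ k else \<eta> $ k) :: real ^ 'n"
    have mix: "?mix S \<in> ref_element" "?\<Psi> (?mix S) \<noteq> 0" for S
      using \<xi> \<eta> by (auto simp: mem_ref_element nonroot)
    have "c (?mix S) = c \<eta>" if "finite S" for S
      using that
    proof (induction S rule: finite_induct)
      case (insert j S)
      have "c (?mix (insert j S)) = c (?mix S)"
        by (rule tensor_poly_quotient_constant_on_line[OF deg eq mix mix, where j = j]) auto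
      with insert.IH show ?case by simp
    qed simp
    from this[of UNIV] show ?thesis by simp
  qed
  have "(0 :: real ^ 'n) \<in> ref_element" by (simp add: mem_ref_element)
  then obtain \<eta> where \<eta>: "\<eta> \<in> ref_element" "?\<Psi> \<eta> \<noteq> 0"
    using tensor_poly_nonzero_approx[OF rodrigues_nonzero[of p], of 0 1] by auto
  have "c \<xi> = c \<eta>" if \<xi>: "\<xi> \<in> ref_element" for \<xi>
  proof (rule ccontr)
    assume "c \<xi> \<noteq> c \<eta>"
    then have "dist (c \<xi>) (c \<eta>) > 0" by simp
    then obtain d where d: "d > 0"
        "\<And>\<zeta>. \<zeta> \<in> ref_element \<Longrightarrow> dist \<zeta> \<xi> < d \<Longrightarrow> dist (c \<zeta>) (c \<xi>) < dist (c \<xi>) (c \<eta>)"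
      using c \<xi> unfolding continuous_on_iff by blast
    obtain \<zeta> where \<zeta>: "\<zeta> \<in> ref_element" "?\<Psi> \<zeta> \<noteq> 0" "dist \<zeta> \<xi> < d"
      using tensor_poly_nonzero_approx[OF rodrigues_nonzero \<xi> d(1)] by blast
    have "c \<zeta> = c \<eta>" by (rule generic[OF \<zeta>(1,2) \<eta>])
    with d(2)[OF \<zeta>(1,3)] show False by (simp add: dist_commute)
  qed
  then show ?thesis by blast
qed

section \<open>The two strong forms differ on a curvilinear element\<close>

theorem theorem1:
  fixes \<Omega> :: "(real ^ 'n) set" and M :: "'m set"
    and \<Theta> :: "'m \<Rightarrow> real ^ 'n \<Rightarrow> real ^ 'n"
    and \<phi> :: "nat \<Rightarrow> real ^ 'n \<Rightarrow> real" and p :: nat and m :: 'm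
  assumes "CARD('n) \<ge> 2"
    and "p \<ge> 1"
    and "tensor_basis p \<phi>"
    and "mesh \<Omega> M \<Theta>"
    and "m \<in> M"
    and "\<not> linear_mapping (\<Theta> m)"
  shows "\<not> (\<forall>(f :: real \<Rightarrow> real ^ 'n) (u :: nat \<Rightarrow> real).
            f C1_differentiable_on UNIV \<longrightarrow>
            (\<forall>i\<in>{1..num_basis TYPE('n) p}.
               conservative_volume_term p \<phi> (\<Theta> m) f u i =
               nonconservative_volume_term p \<phi> (\<Theta> m) f u i))"
proof
  let ?I = "{1..num_basis TYPE('n) p}"
  let ?\<Psi> = "tensor_poly (\<lambda>_ :: 'n. rodrigues p)"
  let ?C = "metric_cofactor (\<Theta> m)"
  assume agree: "\<forall>(f :: real \<Rightarrow> real ^ 'n) u. f C1_differentiable_on UNIV \<longrightarrow>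
     (\<forall>i\<in>?I. conservative_volume_term p \<phi> (\<Theta> m) f u i = nonconservative_volume_term p \<phi> (\<Theta> m) f u i)"
  have \<Theta>: "element_mapping (\<Theta> m)" using assms(4,5) by (simp add: mesh_def)
  obtain q q' :: "nat \<Rightarrow> 'n \<Rightarrow> real poly" where dual: "tensor_dual_bases p ?I q q'"
    and \<phi>: "\<And>i. i \<in> ?I \<Longrightarrow> \<phi> i = tensor_poly (q i)"
    using tensor_basis_dual_bases[OF assms(3)] by blast
  have deg: "degree (q' i k) \<le> p" if "i \<in> ?I" for i k
    using dual that unfolding tensor_dual_bases_def by blast
  have contC: "continuous_on ref_element (\<lambda>\<xi>. ?C \<xi> $ n $ k)" for n k
    by (rule continuous_on_metric_cofactor_component[OF \<Theta>])
  have "\<exists>a. \<forall>\<xi>\<in>ref_element. ?C \<xi> $ n $ k = a" for n k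
  proof -
    obtain \<beta> where \<beta>: "\<And>u. cube_inner
        (\<lambda>\<xi>. ?\<Psi> \<xi> * ?C \<xi> $ n $ k - (\<Sum>j\<in>?I. \<beta> j * tensor_poly (q' j) \<xi>))
        (\<lambda>\<xi>. exp (expansion p \<phi> u \<xi>)) = 0"
      using volume_terms_agree_imp[OF dual \<phi> \<Theta> assms(2), where n = n and ?k0.0 = k] agree by blast
    have "?\<Psi> \<xi> * ?C \<xi> $ n $ k - (\<Sum>j\<in>?I. \<beta> j * tensor_poly (q' j) \<xi>) = 0"
      if \<xi>: "\<xi> \<in> ref_element" for \<xi>
    proof (rule orthogonal_to_exponentials_imp_zero[OF _ _ \<xi>])
      show "continuous_on ref_element
          (\<lambda>\<xi>. ?\<Psi> \<xi> * ?C \<xi> $ n $ k - (\<Sum>j\<in>?I. \<beta> j * tensor_poly (q' j) \<xi>))"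
        by (intro continuous_on_diff continuous_on_mult continuous_on_sum continuous_on_const
            continuous_on_tensor_poly contC)
      fix a :: "real ^ 'n"
      obtain u where "\<And>\<xi>. expansion p \<phi> u \<xi> = a \<bullet> \<xi>"
        using expansion_linear_form[OF dual \<phi> assms(2), of a] by blast
      then show "cube_inner (\<lambda>\<xi>. ?\<Psi> \<xi> * ?C \<xi> $ n $ k - (\<Sum>j\<in>?I. \<beta> j * tensor_poly (q' j) \<xi>))
          (\<lambda>\<xi>. exp (a \<bullet> \<xi>)) = 0"
        using \<beta>[of u] by simp
    qed
    then have "?\<Psi> \<xi> * ?C \<xi> $ n $ k = (\<Sum>j\<in>?I. \<beta> j * tensor_poly (q' j) \<xi>)"
      if "\<xi> \<in> ref_element" for \<xi> using that by simp
    from tensor_poly_quotient_constant[OF deg this contC] show ?thesis .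
  qed
  moreover have "(0 :: real ^ 'n) \<in> ref_element" by (simp add: mem_ref_element)
  ultimately have "?C \<xi> = ?C 0" if "\<xi> \<in> ref_element" for \<xi>
    unfolding vec_eq_iff using that by metis
  then have "linear_mapping (\<Theta> m)"
    by (rule constant_metric_cofactor_imp_linear[OF \<Theta> assms(1)])
  then show False using assms(6) by simp
qed

end
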